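(* Let $N\ge3$ and $t\ge1$ be integers. For $1\le a<b\le N$ let $E_{a,b}=|a\rangle\langle b|-|b\rangle\langle a|$ be the real skew-symmetric $N\times N$ matrix with entries $+1$ at $(a,b)$, $-1$ at $(b,a)$ and zero elsewhere, and let $\mathbf E_N=\{E_{a,b}:1\le a<b\le N\}$. Then \[ \Big\|\mathbb E_{\theta\sim(-\pi,\pi),\,E\in\mathbf E_N}\big(e^{\theta E}\big)^{\otimes t}-\mathbb E_{O\sim\mathrm{SO}(N)}O^{\otimes t}\Big\|\le1-\frac1t\frac{2(N-2)}{N(N-1)}-\frac2{N(N-1)}, \] where $\theta$ and $E$ are independent and uniform and $O$ is Haar-distributed on $\mathrm{SO}(N)$.
   Context: $\|\cdot\|$ is the operator norm. *)

theory Defs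
  imports "HOL-Probability.Probability"
begin

primrec mat_pow :: "real^'n^'n \<Rightarrow> nat \<Rightarrow> real^'n^'n" where
  "mat_pow A 0 = mat 1"
| "mat_pow A (Suc k) = A ** mat_pow A k"

definition mat_exp :: "real^'n^'n \<Rightarrow> real^'n^'n" where
  "mat_exp A = (\<Sum>k. (1 / fact k) *\<^sub>R mat_pow A k)"

definition Emat :: "'n::finite \<Rightarrow> 'n \<Rightarrow> real^'n^'n" where
  "Emat a b = (\<chi> i j. (if i = a \<and> j = b then 1 else 0) - (if i = b \<and> j = a then 1 else 0))"

definition Epairs :: "('n::{finite,linorder} \<times> 'n) set" where
  "Epairs = {(a, b). a < b}"

definition SO :: "(real^'n^'n) set" where
  "SO = {Q. transpose Q ** Q = mat 1 \<and> det Q = 1}"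

definition haar_SO :: "(real^'n^'n) measure \<Rightarrow> bool" where
  "haar_SO \<mu> \<longleftrightarrow> prob_space \<mu> \<and> sets \<mu> = sets borel \<and> emeasure \<mu> SO = 1
     \<and> (\<forall>g\<in>SO. distr \<mu> borel (\<lambda>Q. g ** Q) = \<mu>)"

(* index set of the t-fold tensor power (R^N)^{\<otimes>t}: tuples of length t *)
definition tidx :: "nat \<Rightarrow> 'n::finite list set" where
  "tidx t = {xs. length xs = t}"

(* matrix entries of Q^{\<otimes>t} w.r.t. the product basis *)
definition tens_pow :: "real^'n^'n \<Rightarrow> nat \<Rightarrow> 'n list \<Rightarrow> 'n list \<Rightarrow> real" where
  "tens_pow Q t is js = (\<Prod>k<t. Q $ (is ! k) $ (js ! k))"

definition op_norm :: "'i set \<Rightarrow> ('i \<Rightarrow> 'i \<Rightarrow> real) \<Rightarrow> real" where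
  "op_norm I M = Sup {sqrt (\<Sum>i\<in>I. (\<Sum>j\<in>I. M i j * x j)^2) | x. (\<Sum>j\<in>I. (x j)^2) = 1}"

end

theory Submission
  imports Defs
begin

text \<open>
  Let \<open>L\<^sub>a\<^sub>b\<close> be the action of \<open>E\<^sub>a\<^sub>b\<close> on the \<open>t\<close>-fold tensor power, \<open>P\<^sub>a\<^sub>b\<close> the average of
  \<open>exp (\<theta> L\<^sub>a\<^sub>b)\<close> over \<open>\<theta>\<close>, which is the orthogonal projection onto the kernel of \<open>L\<^sub>a\<^sub>b\<close>, and
  \<open>C = - \<Sum> L\<^sub>a\<^sub>b\<^sup>2\<close> the Casimir operator. From \<open>[L\<^sub>a\<^sub>j, L\<^sub>b\<^sub>j] = - L\<^sub>a\<^sub>b\<close> and \<open>\<parallel>L\<^sub>a\<^sub>b\<parallel> \<le> t\<close> one gets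
  \<open>- L\<^sub>a\<^sub>j\<^sup>2 - L\<^sub>b\<^sub>j\<^sup>2 \<ge> - L\<^sub>a\<^sub>b\<^sup>2 / t\<close>, and summing over \<open>j\<close> gives \<open>C \<ge> - (1 + (N - 2) / t) L\<^sub>a\<^sub>b\<^sup>2\<close>. Since \<open>C\<close>
  commutes with \<open>P\<^sub>a\<^sub>b\<close>, this may be restricted to the range of \<open>1 - P\<^sub>a\<^sub>b\<close>; the sum over \<open>a < b\<close>
  is \<open>C (\<Sum> (1 - P\<^sub>a\<^sub>b)) \<ge> (1 + (N - 2) / t) C\<close>. Testing with an eigenvector of the mean of the
  \<open>P\<^sub>a\<^sub>b\<close> outside the kernel of \<open>C\<close> bounds the eigenvalue. That kernel consists of the vectors
  fixed by all plane rotations, hence by \<open>SO(N)\<close>, and the Haar average projects onto it.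
\<close>

section \<open>Operator norms and eigenvalues\<close>

text \<open>The index set is explicit because the basis of the tensor power, \<open>tidx n\<close>,
  is a finite part of the infinite type of lists. Vectors are functions on the whole type, compared
  only on \<open>I\<close>.\<close>

definition ip :: "'i set \<Rightarrow> ('i \<Rightarrow> real) \<Rightarrow> ('i \<Rightarrow> real) \<Rightarrow> real" where
  "ip I x y = (\<Sum>i\<in>I. x i * y i)"

lemma ip_commute: "ip I x y = ip I y x"
  by (simp add: ip_def mult.commute)

lemma ip_add_left: "ip I (\<lambda>i. x i + y i) z = ip I x z + ip I y z"
  by (simp add: ip_def sum.distrib algebra_simps)

lemma ip_diff_left: "ip I (\<lambda>i. x i - y i) z = ip I x z - ip I y z"
  by (simp add: ip_def sum_subtractf algebra_simps)

lemma ip_scale_left: "ip I (\<lambda>i. c * x i) z = c * ip I x z"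
  by (simp add: ip_def sum_distrib_left algebra_simps)

lemma ip_minus_left: "ip I (\<lambda>i. - x i) z = - ip I x z"
  by (simp add: ip_def sum_negf)

lemma ip_sum_left: "ip I (\<lambda>i. \<Sum>k\<in>S. f k i) z = (\<Sum>k\<in>S. ip I (f k) z)"
  unfolding ip_def by (simp add: sum_distrib_right) (rule sum.swap)

lemma ip_add_right: "ip I z (\<lambda>i. x i + y i) = ip I z x + ip I z y"
  and ip_diff_right: "ip I z (\<lambda>i. x i - y i) = ip I z x - ip I z y"
  and ip_scale_right: "ip I z (\<lambda>i. c * x i) = c * ip I z x"
  and ip_minus_right: "ip I z (\<lambda>i. - x i) = - ip I z x"
  by (simp_all add: ip_commute[of I z] ip_add_left ip_diff_left ip_scale_left ip_minus_left)

lemma ip_sum_right: "ip I z (\<lambda>i. \<Sum>k\<in>S. f k i) = (\<Sum>k\<in>S. ip I z (f k))"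
  by (simp add: ip_commute[of I z] ip_sum_left)

lemmas ip_linear = ip_add_left ip_diff_left ip_scale_left ip_minus_left
  ip_add_right ip_diff_right ip_scale_right ip_minus_right

lemma ip_cong: "(\<And>i. i \<in> I \<Longrightarrow> x i = x' i) \<Longrightarrow> (\<And>i. i \<in> I \<Longrightarrow> y i = y' i) \<Longrightarrow> ip I x y = ip I x' y'"
  by (simp add: ip_def)

lemma ip_nonneg: "0 \<le> ip I x x"
  by (simp add: ip_def sum_nonneg)

lemma ip_eq_0_iff: "finite I \<Longrightarrow> ip I x x = 0 \<longleftrightarrow> (\<forall>i\<in>I. x i = 0)"
  by (simp add: ip_def sum_nonneg_eq_0_iff)

text \<open>Forcing zeros off \<open>I\<close> places the sphere inside a product of intervals
  \<open>{-1..1}\<close> and singletons, which is compact by Tychonoff even when the index type is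
  infinite.\<close>

lemma compact_unit_sphere_ip:
  assumes "finite I"
  shows "compact {x :: 'i \<Rightarrow> real. (\<forall>i. i \<notin> I \<longrightarrow> x i = 0) \<and> ip I x x = 1}" (is "compact ?S")
proof -
  let ?B = "\<lambda>i. if i \<in> I then {-1..1::real} else {0}"
  have "compact_space (product_topology (\<lambda>i. subtopology euclidean (?B i)) UNIV)"
    by (auto simp: compact_space_product_topology compact_space_subtopology)
  then have "compactin (product_topology (\<lambda>i::'i. euclidean :: real topology) UNIV) (PiE UNIV ?B)"
    by (auto simp: compactin_PiE)
  then have K: "compact (PiE UNIV ?B)"
    by (simp add: euclidean_product_topology)
  have cI: "continuous_on UNIV (\<lambda>x::'i \<Rightarrow> real. ip I x x)"
    unfolding ip_def by (intro continuous_intros continuous_on_product_coordinates)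
  have cz: "closed {x :: 'i \<Rightarrow> real. x i = 0}" for i
    by (intro closed_Collect_eq continuous_on_product_coordinates continuous_intros)
  have "closed ((\<Inter>i\<in>-I. {x :: 'i \<Rightarrow> real. x i = 0}) \<inter> {x. ip I x x = 1})"
    by (intro closed_Int closed_INT ballI cz closed_Collect_eq cI continuous_intros)
  moreover have "?S = (\<Inter>i\<in>-I. {x :: 'i \<Rightarrow> real. x i = 0}) \<inter> {x. ip I x x = 1}"
    by auto
  ultimately have "closed ?S" by simp
  moreover have "?S \<subseteq> PiE UNIV ?B"
  proof (clarsimp simp: PiE_iff)
    fix x :: "'i \<Rightarrow> real" and i assume "ip I x x = 1" "i \<in> I"
    then have "x i * x i \<le> 1"
      unfolding ip_def using member_le_sum[of i I "\<lambda>i. x i * x i"] assms by auto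
    then have "\<bar>x i\<bar> \<le> 1" using abs_le_square_iff[of "x i" 1] by (simp add: power2_eq_square)
    then show "- 1 \<le> x i \<and> x i \<le> 1" by auto
  qed
  ultimately show ?thesis
    using compact_Int_closed[OF K \<open>closed ?S\<close>] by (simp only: Int_absorb1)
qed

text \<open>The first-order condition at a minimum, obtained by testing
  \<open>s = - b / (c + 1)\<close>; the shift by 1 keeps the quotient meaningful for
  \<open>c = 0\<close>.\<close>

lemma nonneg_quadratic_imp_linear_coeff_0:
  fixes b c :: real
  assumes "\<And>s. 0 \<le> 2 * s * b + s\<^sup>2 * c" "0 \<le> c"
  shows "b = 0"
proof (rule ccontr)
  assume "b \<noteq> 0"
  define r where "r = b / (c+1)"
  have "b = r * (c + 1)" using assms(2) by (simp add: r_def)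
  then have "2 * (- r) * b + (- r)\<^sup>2 * c = - (r\<^sup>2 * (c + 2))"
    by (simp add: algebra_simps power2_eq_square)
  moreover have "0 < r\<^sup>2 * (c + 2)"
    using \<open>b \<noteq> 0\<close> assms(2) by (simp add: r_def)
  ultimately show False using assms(1)[of "- r"] by linarith
qed

text \<open>A minimal spectral theorem. A maximiser \<open>x0\<close> of the squared norm of
  \<open>A x\<close> on the unit sphere satisfies \<open>A (A x0) = m * x0\<close>. For
  \<open>l = sqrt m > 0\<close> the vector \<open>A x0 + l * x0\<close> is then an eigenvector for
  \<open>l\<close>, since positivity of \<open>A\<close> excludes \<open>A x0 = - l * x0\<close>. So
  the norm is itself 0 or an eigenvalue.\<close>

lemma op_norm_le_eigenvalue_bound:
  fixes I :: "'i set" and M :: "'i \<Rightarrow> 'i \<Rightarrow> real" and q :: real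
  defines "A \<equiv> \<lambda>x i. \<Sum>j\<in>I. M i j * x j"
  assumes fin: "finite I" and ne: "I \<noteq> {}" and q: "0 \<le> q"
    and sym: "\<And>x y. ip I (A x) y = ip I x (A y)"
    and psd: "\<And>x. 0 \<le> ip I (A x) x"
    and eig: "\<And>l v. 0 < l \<Longrightarrow> \<exists>i\<in>I. v i \<noteq> 0 \<Longrightarrow> \<forall>i\<in>I. A v i = l * v i \<Longrightarrow> l \<le> q"
  shows "op_norm I M \<le> q"
proof -
  define S where "S = {x :: 'i \<Rightarrow> real. (\<forall>i. i \<notin> I \<longrightarrow> x i = 0) \<and> ip I x x = 1}"
  define f where "f = (\<lambda>x. ip I (A x) (A x))"
  have A_add: "A (\<lambda>i. x i + y i) = (\<lambda>i. A x i + A y i)" for x y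
    by (auto simp: A_def sum.distrib algebra_simps)
  have A_scale: "A (\<lambda>i. c * x i) = (\<lambda>i. c * A x i)" for c x
    by (auto simp: A_def sum_distrib_left algebra_simps)
  have A_cong: "(\<And>i. i \<in> I \<Longrightarrow> x i = y i) \<Longrightarrow> A x = A y" for x y
    by (auto simp: A_def)
  obtain i0 where i0: "i0 \<in> I" using ne by auto
  have "(\<lambda>i. if i = i0 then 1 else 0) \<in> S"
    using i0 fin by (auto simp: S_def ip_def if_distrib cong: if_cong)
  then have "S \<noteq> {}" by auto
  moreover have "continuous_on S f"
    unfolding f_def A_def ip_def
    by (intro continuous_intros continuous_on_subset[OF continuous_on_product_coordinates]) auto
  moreover have "compact S" unfolding S_def by (rule compact_unit_sphere_ip[OF fin])
  ultimately obtain x0 where x0: "x0 \<in> S" and max: "\<And>x. x \<in> S \<Longrightarrow> f x \<le> f x0"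
    using continuous_attains_sup[of S f] by blast
  define m where "m = f x0"
  have m0: "0 \<le> m" by (simp add: m_def f_def ip_nonneg)
  have x01: "ip I x0 x0 = 1" using x0 by (simp add: S_def)
  \<comment> \<open>Homogeneity carries the maximum from the sphere to all vectors, so that
    perturbations of \<open>x0\<close> need not be normalised.\<close>
  have bound: "f z \<le> m * ip I z z" for z
  proof (cases "ip I z z = 0")
    case True
    then have "\<forall>i\<in>I. z i = 0" using fin by (simp add: ip_eq_0_iff)
    then have "A z = (\<lambda>i. 0)" by (simp add: A_def)
    then show ?thesis using True by (simp add: f_def ip_def)
  next
    case False
    define r where "r = ip I z z"
    have r: "r > 0" using False ip_nonneg[of I z] by (simp add: r_def)
    define y where "y = (\<lambda>i. if i \<in> I then (1 / sqrt r) * z i else 0)"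
    have "ip I y y = ip I (\<lambda>i. (1 / sqrt r) * z i) (\<lambda>i. (1 / sqrt r) * z i)"
      by (intro ip_cong) (auto simp: y_def)
    also have "\<dots> = 1"
      using r unfolding ip_linear by (simp add: r_def)
    finally have "y \<in> S" by (auto simp: S_def y_def)
    then have "f y \<le> m" using max by (simp add: m_def)
    moreover have "A y = (\<lambda>i. (1 / sqrt r) * A z i)"
      using A_cong[of y "\<lambda>i. (1 / sqrt r) * z i"] unfolding A_scale[symmetric] by (simp add: y_def)
    then have "f y = f z / r"
      unfolding f_def using r by (simp only: ip_linear) simp
    ultimately show ?thesis using r by (simp add: field_simps flip: r_def)
  qed
  \<comment> \<open>First variation of the nonnegative function \<open>m * ip I x x - f x\<close> at
    its zero \<open>x0\<close>, in direction \<open>z\<close>.\<close>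
  have crit: "ip I (A (A x0)) z = m * ip I x0 z" for z
  proof -
    have "m * ip I x0 z - ip I (A x0) (A z) = 0"
    proof (rule nonneg_quadratic_imp_linear_coeff_0)
      fix s :: real
      have "0 \<le> m * ip I (\<lambda>i. x0 i + s * z i) (\<lambda>i. x0 i + s * z i) - f (\<lambda>i. x0 i + s * z i)"
        using bound[of "\<lambda>i. x0 i + s * z i"] by simp
      also have "\<dots> = 2 * s * (m * ip I x0 z - ip I (A x0) (A z)) + s\<^sup>2 * (m * ip I z z - f z)"
        by (simp add: f_def A_add A_scale ip_linear x01 m_def[unfolded f_def, symmetric]
            ip_commute[of I z x0] ip_commute[of I "A z" "A x0"] power2_eq_square algebra_simps)
      finally show "0 \<le> \<dots>" .
    qed (use bound[of z] in simp)
    then show ?thesis by (simp add: sym)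
  qed
  have AA: "A (A x0) i = m * x0 i" if "i \<in> I" for i
  proof -
    define y where "y = (\<lambda>i. A (A x0) i - m * x0 i)"
    have "ip I y y = 0"
      using crit[of y] by (subst y_def) (simp add: ip_linear)
    then show ?thesis using that fin by (simp add: ip_eq_0_iff y_def)
  qed
  define l where "l = sqrt m"
  have ll: "l * l = m" using m0 by (simp add: l_def)
  have "l \<le> q"
  proof (cases "l = 0")
    case False
    then have lpos: "l > 0" using m0 by (simp add: l_def)
    \<comment> \<open>\<open>(A - l) (A + l) x0 = 0\<close>, so \<open>w = (A + l) x0\<close> lies
      in the eigenspace of \<open>l\<close>.\<close>
    define w where "w = (\<lambda>i. A x0 i + l * x0 i)"
    have "\<exists>i\<in>I. w i \<noteq> 0"
    proof (rule ccontr)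
      assume "\<not> ?thesis"
      then have "ip I (A x0) x0 = ip I (\<lambda>i. - l * x0 i) x0"
        by (intro ip_cong) (auto simp: w_def add_eq_0_iff)
      also have "\<dots> = - l" by (simp only: ip_scale_left x01)
      finally show False using psd[of x0] lpos by simp
    qed
    moreover have "\<forall>i\<in>I. A w i = l * w i"
      unfolding w_def by (simp add: A_add A_scale AA ll[symmetric] algebra_simps)
    ultimately show ?thesis using eig lpos by blast
  qed (use q in simp)
  have "sqrt (\<Sum>i\<in>I. (\<Sum>j\<in>I. M i j * x j)^2) \<le> q" if "(\<Sum>j\<in>I. (x j)^2) = 1" for x
  proof -
    have "f x \<le> m" using bound[of x] that by (simp add: ip_def power2_eq_square)
    then have "sqrt (f x) \<le> l" by (simp add: l_def)
    then show ?thesis using \<open>l \<le> q\<close> by (simp add: f_def ip_def A_def power2_eq_square)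
  qed
  moreover have "(\<Sum>j\<in>I. (x0 j)^2) = 1" using x01 by (simp add: ip_def power2_eq_square)
  ultimately show ?thesis
    unfolding op_norm_def by (intro cSup_least) auto
qed

section \<open>Plane rotations\<close>

lemma Emat_nth: "Emat a b $ i $ j = (if i = a \<and> j = b then 1 else 0) - (if i = b \<and> j = a then 1 else 0)"
  by (simp add: Emat_def)

lemma Emat_mult_nth: "(Emat a b ** M) $ i $ j = (if i = a then M $ b $ j else 0) - (if i = b then M $ a $ j else 0)"
  for M :: "real^'m^'n"
proof -
  have "(Emat a b ** M) $ i $ j =
      (\<Sum>k\<in>UNIV. (if k = b then (if i = a then M $ k $ j else 0) else 0) - (if k = a then (if i = b then M $ k $ j else 0) else 0))"
    by (auto simp: matrix_matrix_mult_def Emat_nth intro!: sum.cong)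
  then show ?thesis by (simp add: sum_subtractf)
qed

lemma Emat_swap: "Emat b a = - Emat a b"
  by (simp add: vec_eq_iff Emat_nth)

lemma Emat_self: "Emat a a = 0"
  by (simp add: vec_eq_iff Emat_nth)

lemma transpose_Emat: "transpose (Emat a b) = - Emat a b"
  unfolding Emat_swap[of b a, symmetric] by (simp add: Emat_def transpose_def conj_commute)

text \<open>The structure constants of the Lie algebra so(N), with all coincidences among the four
  indices allowed.\<close>

lemma Emat_bracket:
  "Emat a b ** Emat c d - Emat c d ** Emat a b =
     (if b = c then Emat a d else 0) - (if a = c then Emat b d else 0)
   - (if b = d then Emat a c else 0) + (if a = d then Emat b c else 0)"
  by (auto simp: vec_eq_iff Emat_nth Emat_mult_nth)

text \<open>Rodrigues' closed form of the exponential of \<open>\<theta> *\<^sub>R Emat a b\<close>,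
  valid because the cube of \<open>Emat a b\<close> is its negative.\<close>

definition rot :: "'n::finite \<Rightarrow> 'n \<Rightarrow> real \<Rightarrow> real^'n^'n" where
  "rot a b \<theta> = mat 1 + sin \<theta> *\<^sub>R Emat a b + (1 - cos \<theta>) *\<^sub>R (Emat a b ** Emat a b)"

lemma Emat_cube: "a \<noteq> b \<Longrightarrow> Emat a b ** (Emat a b ** Emat a b) = - Emat a b"
  by (simp add: vec_eq_iff Emat_nth Emat_mult_nth)

lemma scaleR_matrix_mult: "(c *\<^sub>R A) ** B = c *\<^sub>R (A ** B)"
  and matrix_mult_scaleR: "A ** (c *\<^sub>R B) = c *\<^sub>R (A ** B)"
  for A :: "real^'m^'n" and B :: "real^'k^'m"
  by (simp_all add: vec_eq_iff matrix_matrix_mult_def sum_distrib_left mult.assoc mult.left_commute)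

lemma matrix_mult_add_right: "A ** (B + C) = A ** B + A ** C"
  and matrix_mult_add_left: "(A + D) ** B = A ** B + D ** B"
  for A D :: "real^'m^'n" and B C :: "real^'k^'m"
  by (simp_all add: vec_eq_iff matrix_matrix_mult_def distrib_left distrib_right sum.distrib)

lemma matrix_mult_diff_right: "A ** (B - C) = A ** B - A ** C"
  for A :: "real^'m^'n" and B C :: "real^'k^'m"
  by (simp add: vec_eq_iff matrix_matrix_mult_def right_diff_distrib sum_subtractf)

lemma mat_pow_scaleR: "mat_pow (c *\<^sub>R A) k = c ^ k *\<^sub>R mat_pow A k"
  by (induction k) (simp_all add: scaleR_matrix_mult matrix_mult_scaleR mult.commute)

lemma mat_exp_Emat:
  assumes "a \<noteq> b"
  shows "mat_exp (\<theta> *\<^sub>R Emat a b) = rot a b \<theta>"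
proof -
  let ?E = "Emat a b" 
  \<comment> \<open>The powers of \<open>?E\<close> cycle through \<open>?E\<close> and its square
    up to sign, leaving the Taylor coefficients of sine and of 1 minus cosine; the case
    \<open>k = 0\<close> contributes the identity alone.\<close>
  have pow: "(1 / fact k) *\<^sub>R mat_pow ?E k =
      (if k = 0 then mat 1 else 0) + sin_coeff k *\<^sub>R ?E + ((if k = 0 then 1 else 0) - cos_coeff k) *\<^sub>R (?E ** ?E)" for k
  proof (induction k)
    case (Suc k)
    have "(1 / fact (Suc k)) *\<^sub>R mat_pow ?E (Suc k) = (1 / real (Suc k)) *\<^sub>R (?E ** ((1 / fact k) *\<^sub>R mat_pow ?E k))"
      by (simp add: matrix_mult_scaleR)
    also have "\<dots> = (1 / real (Suc k)) *\<^sub>R (cos_coeff k *\<^sub>R ?E + sin_coeff k *\<^sub>R (?E ** ?E))"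
      unfolding Suc using assms
      by (simp add: matrix_mult_add_right matrix_mult_diff_right matrix_mult_scaleR Emat_cube algebra_simps)
    finally show ?case
      by (simp add: sin_coeff_Suc cos_coeff_Suc scaleR_add_right)
  qed (simp add: sin_coeff_def cos_coeff_def)
  have summand: "(1 / fact k) *\<^sub>R mat_pow (\<theta> *\<^sub>R ?E) k =
      (if k = 0 then mat 1 else 0) + (sin_coeff k *\<^sub>R \<theta> ^ k) *\<^sub>R ?E
      + ((if k = 0 then 1 else 0) - cos_coeff k *\<^sub>R \<theta> ^ k) *\<^sub>R (?E ** ?E)" for k
  proof -
    have "(1 / fact k) *\<^sub>R mat_pow (\<theta> *\<^sub>R ?E) k = \<theta> ^ k *\<^sub>R ((1 / fact k) *\<^sub>R mat_pow ?E k)"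
      by (simp add: mat_pow_scaleR)
    also have "\<dots> = (if k = 0 then mat 1 else 0) + (sin_coeff k *\<^sub>R \<theta> ^ k) *\<^sub>R ?E
      + ((if k = 0 then 1 else 0) - cos_coeff k *\<^sub>R \<theta> ^ k) *\<^sub>R (?E ** ?E)"
      unfolding pow by (simp add: algebra_simps)
    finally show ?thesis .
  qed
  have one: "(\<lambda>k. if k = 0 then c else 0) sums c" for c :: "'x::real_normed_vector"
    by (rule sums_single)
  have s1: "(\<lambda>k. (sin_coeff k *\<^sub>R \<theta> ^ k) *\<^sub>R ?E) sums (sin \<theta> *\<^sub>R ?E)"
    by (rule bounded_linear.sums[OF bounded_linear_scaleR_left sin_converges])
  have s2: "(\<lambda>k. ((if k = 0 then 1 else 0) - cos_coeff k *\<^sub>R \<theta> ^ k) *\<^sub>R (?E ** ?E))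
      sums ((1 - cos \<theta>) *\<^sub>R (?E ** ?E))"
    by (rule bounded_linear.sums[OF bounded_linear_scaleR_left sums_diff[OF one cos_converges]])
  have "(\<lambda>k. (1 / fact k) *\<^sub>R mat_pow (\<theta> *\<^sub>R ?E) k) sums rot a b \<theta>"
    unfolding summand rot_def by (rule sums_add[OF sums_add[OF one s1] s2])
  then show ?thesis unfolding mat_exp_def by (rule sums_unique[symmetric])
qed

lemma rot_mult_nth:
  assumes "a \<noteq> b"
  shows "(rot a b \<theta> ** M) $ i $ j = (if i = a then cos \<theta> * M $ a $ j + sin \<theta> * M $ b $ j
     else if i = b then cos \<theta> * M $ b $ j - sin \<theta> * M $ a $ j else M $ i $ j)"
proof -
  have eq: "rot a b \<theta> ** M = M + sin \<theta> *\<^sub>R (Emat a b ** M) + (1 - cos \<theta>) *\<^sub>R (Emat a b ** (Emat a b ** M))"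
    unfolding rot_def
    by (simp add: matrix_mult_add_left matrix_mul_assoc scaleR_matrix_mult)
  show ?thesis unfolding eq using assms by (simp add: Emat_mult_nth algebra_simps)
qed

lemma rot_nth:
  assumes "a \<noteq> b"
  shows "rot a b \<theta> $ i $ j = (if i = j then (if i = a \<or> i = b then cos \<theta> else 1) else sin \<theta> * Emat a b $ i $ j)"
  using assms by (auto simp: rot_def mat_def Emat_nth Emat_mult_nth)

lemma rot_0: "rot a b 0 = mat 1"
  by (simp add: rot_def)

lemma rot_add: "a \<noteq> b \<Longrightarrow> rot a b \<theta> ** rot a b \<phi> = rot a b (\<theta> + \<phi>)"
  by (auto simp: vec_eq_iff rot_mult_nth rot_nth Emat_nth cos_add sin_add)

lemma transpose_rot: "a \<noteq> b \<Longrightarrow> transpose (rot a b \<theta>) = rot a b (- \<theta>)"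
  by (auto simp: vec_eq_iff transpose_def rot_nth Emat_nth)

lemma rot_in_SO: "a \<noteq> b \<Longrightarrow> rot a b \<theta> \<in> SO"
proof -
  assume ab: "a \<noteq> b"
  have orth: "transpose (rot a b \<phi>) ** rot a b \<phi> = mat 1" for \<phi>
    by (simp add: ab transpose_rot rot_add rot_0)
  \<comment> \<open>Orthogonality only gives determinant 1 or -1. At half the angle the square is 1,
    and this square is the determinant at \<open>\<theta>\<close>.\<close>
  then have "det (rot a b (\<theta>/2)) * det (rot a b (\<theta>/2)) = 1"
    by (metis det_I det_mul det_transpose)
  then have "det (rot a b \<theta>) = 1"
    using rot_add[OF ab, of "\<theta>/2" "\<theta>/2"] by (metis det_mul field_sum_of_halves)
  with orth show ?thesis by (simp add: SO_def)
qed

lemma SO_mult: "A \<in> SO \<Longrightarrow> B \<in> SO \<Longrightarrow> A ** B \<in> SO"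
  unfolding SO_def
  by (auto simp: det_mul matrix_transpose_mul) (metis matrix_mul_assoc matrix_mul_lid)

lemma SO_transpose: "A \<in> SO \<Longrightarrow> transpose A \<in> SO"
  unfolding SO_def by (auto simp: matrix_left_right_inverse)

lemma SO_one: "mat 1 \<in> SO"
  by (simp add: SO_def transpose_mat)

section \<open>Generation of the special orthogonal group by plane rotations\<close>

inductive_set rots :: "(real^'n^'n) set" where
  one: "mat 1 \<in> rots"
| mult: "a \<noteq> b \<Longrightarrow> A \<in> rots \<Longrightarrow> rot a b \<theta> ** A \<in> rots"

lemma rots_mult: "A \<in> rots \<Longrightarrow> B \<in> rots \<Longrightarrow> A ** B \<in> rots"
  by (induction rule: rots.induct) (auto simp: matrix_mul_assoc[symmetric] intro: rots.intros)

lemma rots_transpose: "A \<in> rots \<Longrightarrow> transpose A \<in> rots"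
proof (induction rule: rots.induct)
  case (mult a b A \<theta>)
  then have "rot a b (- \<theta>) \<in> rots" using rots.mult[OF _ rots.one, of a b "- \<theta>"] by simp
  then show ?case using mult by (simp add: matrix_transpose_mul transpose_rot rots_mult)
qed (simp add: transpose_mat rots.one)

lemma rots_subset_SO: "A \<in> rots \<Longrightarrow> A \<in> SO"
  by (induction rule: rots.induct) (auto intro: SO_one SO_mult rot_in_SO)

text \<open>Givens elimination: one rotation in the plane of \<open>s\<close> and \<open>j\<close>
  for each \<open>j\<close> in \<open>F\<close> clears column \<open>s\<close> in the rows of
  \<open>F\<close>. Rows outside stay untouched, and columns that vanish on the active rows keep
  doing so. The sign of the pivot is controlled once at least one rotation has been applied.\<close>

lemma rots_eliminate:
  fixes Q :: "real^'n^'n"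
  assumes "finite F" "s \<notin> F"
  shows "\<exists>G\<in>rots. (\<forall>i. i \<notin> insert s F \<longrightarrow> (G ** Q) $ i = Q $ i)
     \<and> (\<forall>i. (\<forall>k\<in>insert s F. Q $ k $ i = 0) \<longrightarrow> (\<forall>k\<in>insert s F. (G ** Q) $ k $ i = 0))
     \<and> (\<forall>j\<in>F. (G ** Q) $ j $ s = 0) \<and> (F \<noteq> {} \<longrightarrow> 0 \<le> (G ** Q) $ s $ s)"
  using assms
proof (induction F)
  case empty
  then show ?case by (intro bexI[of _ "mat 1"]) (auto intro: rots.one)
next
  case (insert j F)
  have sF: "s \<notin> F" using insert.prems by simp
  from insert.IH[OF sF] obtain G where GI: "G \<in> rots"
      "(\<forall>i. i \<notin> insert s F \<longrightarrow> (G ** Q) $ i = Q $ i)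
     \<and> (\<forall>i. (\<forall>k\<in>insert s F. Q $ k $ i = 0) \<longrightarrow> (\<forall>k\<in>insert s F. (G ** Q) $ k $ i = 0))
     \<and> (\<forall>j\<in>F. (G ** Q) $ j $ s = 0)"
    by (elim bexE conjE) simp
  note G = GI(1) GI(2)[THEN conjunct1, rule_format] GI(2)[THEN conjunct2, THEN conjunct1, rule_format]
    GI(2)[THEN conjunct2, THEN conjunct2, rule_format]
  define R where "R = G ** Q"
  have sj: "s \<noteq> j" using insert by auto
  \<comment> \<open>Polar coordinates of the pivot and the entry to be cleared: rotating by the
    argument sends the pair to \<open>(r, 0)\<close> with \<open>r\<close> the modulus.\<close>
  define z where "z = Complex (R $ s $ s) (R $ j $ s)"
  define r \<theta> where "r = cmod z" and "\<theta> = Arg z"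
  have "rcis r \<theta> = z" by (simp add: r_def \<theta>_def rcis_cmod_Arg)
  then have xy: "R $ s $ s = r * cos \<theta>" "R $ j $ s = r * sin \<theta>"
    by (simp_all add: z_def rcis_def cis.ctr complex_eq_iff)
  have r0: "0 \<le> r" by (simp add: r_def)
  have "r = r * ((cos \<theta>)\<^sup>2 + (sin \<theta>)\<^sup>2)" by simp
  then have rss: "cos \<theta> * R $ s $ s + sin \<theta> * R $ j $ s = r"
    unfolding xy by (simp only: distrib_left power2_eq_square mult.left_commute)
  define T where "T = rot s j \<theta> ** R"
  have T_nth: "T $ i $ k = (if i = s then cos \<theta> * R $ s $ k + sin \<theta> * R $ j $ k
     else if i = j then cos \<theta> * R $ j $ k - sin \<theta> * R $ s $ k else R $ i $ k)" for i k
    by (simp add: T_def rot_mult_nth[OF sj])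
  have c1: "T $ i = Q $ i" if "i \<notin> insert s (insert j F)" for i
    using G(2)[of i] that by (simp add: vec_eq_iff T_nth flip: R_def)
  have c2: "T $ k $ i = 0"
    if z: "\<forall>k\<in>insert s (insert j F). Q $ k $ i = 0" and k: "k \<in> insert s (insert j F)" for i k
  proof -
    have "R $ l $ i = 0" if "l \<in> insert s F" for l
      using G(3)[of i l] z that by (auto simp: R_def)
    moreover have "R $ j $ i = 0"
      using G(2)[of j] z insert by (auto simp: R_def)
    ultimately show ?thesis
      using k by (auto simp: T_nth)
  qed
  have c3: "T $ i $ s = 0" if i: "i \<in> insert j F" for i
  proof (cases "i = j")
    case True
    then show ?thesis using sj by (simp add: T_nth xy)
  next
    case False
    then have "i \<in> F" "i \<noteq> s" using i insert by auto
    then show ?thesis using False G(4)[of i] by (simp add: T_nth flip: R_def)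
  qed
  have c4: "0 \<le> T $ s $ s" using rss r0 by (simp add: T_nth)
  have c5: "rot s j \<theta> ** G \<in> rots" using sj G(1) by (rule rots.mult)
  have c6: "(rot s j \<theta> ** G) ** Q = T"
    by (simp add: T_def R_def matrix_mul_assoc)
  show ?case
  proof (rule bexI[OF _ c5], unfold c6, intro conjI allI ballI impI)
    show "T $ i = Q $ i" if "i \<notin> insert s (insert j F)" for i using that by (rule c1)
    show "T $ k $ i = 0" if "\<forall>k\<in>insert s (insert j F). Q $ k $ i = 0" "k \<in> insert s (insert j F)" for i k
      using that by (rule c2)
    show "T $ i $ s = 0" if "i \<in> insert j F" for i using that by (rule c3)
  qed (rule c4)
qed

lemma SO_column_inner:
  fixes Q :: "real^'n^'n"
  assumes "Q \<in> SO"
  shows "(\<Sum>k\<in>UNIV. Q $ k $ i * Q $ k $ j) = (if i = j then 1 else 0)"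
proof -
  have "(transpose Q ** Q) $ i $ j = mat 1 $ i $ j" using assms by (simp add: SO_def)
  then show ?thesis by (simp add: matrix_matrix_mult_def transpose_def mat_def)
qed

lemma SO_row_of_fixed_axis:
  fixes Q :: "real^'n^'n"
  assumes "Q \<in> SO" "\<And>k. Q $ k $ i = (if k = i then 1 else 0)" "j \<noteq> i"
  shows "Q $ i $ j = 0"
  using SO_column_inner[OF assms(1), of i j] assms(2,3) by (simp add: if_distrib[of "\<lambda>x. x * _"] cong: if_cong)

text \<open>Orthogonality to the other columns, which are basis vectors, makes the matrix diagonal;
  the determinant then forces the last diagonal entry.\<close>

lemma SO_eq_one:
  fixes Q :: "real^'n^'n"
  assumes Q: "Q \<in> SO" and axes: "\<And>i k. i \<noteq> s \<Longrightarrow> Q $ k $ i = (if k = i then 1 else 0)"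
  shows "Q = mat 1"
proof -
  have 1: "Q $ k $ s = 0" if "k \<noteq> s" for k
    using SO_row_of_fixed_axis[OF Q, of k s] axes[OF that] that by auto
  have "det Q = (\<Prod>i\<in>UNIV. Q $ i $ i)"
    by (rule det_diagonal) (metis axes 1)
  also have "\<dots> = (\<Prod>i\<in>UNIV. if i = s then Q $ s $ s else 1)"
    by (intro prod.cong) (auto simp: axes)
  finally have "Q $ s $ s = 1" using Q by (simp add: SO_def)
  then have "Q $ i $ j = mat 1 $ i $ j" for i j
    by (cases "j = s"; cases "i = j") (auto simp: 1 axes mat_def)
  then show ?thesis by (simp add: vec_eq_iff)
qed

lemma SO_subset_rots:
  fixes Q :: "real^'n^'n"
  assumes "Q \<in> SO"
  shows "Q \<in> rots"
proof -
  \<comment> \<open>Induction on the set \<open>S\<close> of axes that \<open>Q\<close> may still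
    move; each step eliminates one column and passes to the remaining axes.\<close>
  have "Q \<in> rots" if "finite S" "Q \<in> SO" "\<And>i k. i \<notin> S \<Longrightarrow> Q $ k $ i = (if k = i then 1 else 0)"
    for S :: "'n set" and Q :: "real^'n^'n"
    using that
  proof (induction S arbitrary: Q)
    case empty
    then have "Q = mat 1" using SO_eq_one[of Q] by blast
    then show ?case by (simp add: rots.one)
  next
    case (insert s F)
    show ?case
    \<comment> \<open>With a single axis left no rotation is available to correct the sign of the
      last entry, and the determinant condition decides it.\<close>
    proof (cases "F = {}")
      case True
      then have "Q = mat 1" using SO_eq_one[of Q s] insert by simp
      then show ?thesis by (simp add: rots.one)
    next
      case False
      from rots_eliminate[OF insert(1,2), of Q] False obtain G where G: "G \<in> rots"
        "\<forall>i. i \<notin> insert s F \<longrightarrow> (G ** Q) $ i = Q $ i"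
        "\<forall>i. (\<forall>k\<in>insert s F. Q $ k $ i = 0) \<longrightarrow> (\<forall>k\<in>insert s F. (G ** Q) $ k $ i = 0)"
        "\<forall>j\<in>F. (G ** Q) $ j $ s = 0" "0 \<le> (G ** Q) $ s $ s"
        by (elim bexE conjE) simp
      define R where "R = G ** Q"
      have RSO: "R \<in> SO" using G(1) insert.prems(1) by (simp add: R_def SO_mult rots_subset_SO)
      have fixed: "R $ k $ i = (if k = i then 1 else 0)" if "i \<notin> insert s F" for i k
      proof (cases "k \<in> insert s F")
        case True
        have "Q $ l $ i = 0" if "l \<in> insert s F" for l
          using insert.prems(2)[of i l] that \<open>i \<notin> insert s F\<close> by auto
        then have "\<forall>k\<in>insert s F. R $ k $ i = 0" using G(3) by (simp add: R_def)
        then have "R $ k $ i = 0" using True by blast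
        then show ?thesis using True that by auto
      next
        case False
        then show ?thesis using G(2) insert.prems(2)[OF that] by (simp add: R_def)
      qed
      \<comment> \<open>Rows in \<open>F\<close> were cleared by the elimination; rows outside
        \<open>insert s F\<close> vanish by orthogonality to the axes already fixed.\<close>
      have Rs: "R $ k $ s = 0" if "k \<noteq> s" for k
      proof (cases "k \<in> F")
        case True
        then show ?thesis using G(4) by (simp add: R_def)
      next
        case False
        then have "k \<notin> insert s F" using that by auto
        then show ?thesis using SO_row_of_fixed_axis[OF RSO fixed] that by metis
      qed
      have "(\<Sum>k\<in>UNIV. R $ k $ s * R $ k $ s) = (\<Sum>k\<in>UNIV. if k = s then R $ s $ s * R $ s $ s else 0)"
        by (intro sum.cong) (auto simp: Rs)
      then have "R $ s $ s * R $ s $ s = 1" using SO_column_inner[OF RSO, of s s] by simp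
      moreover have "0 \<le> R $ s $ s" using G(5) by (simp add: R_def)
      ultimately have "R $ s $ s = 1" by (metis abs_of_nonneg abs_mult_self_eq real_sqrt_abs2 real_sqrt_one)
      then have "R \<in> rots" using Rs fixed
        by (intro insert.IH[OF RSO]) (metis insert_iff)
      moreover have "Q = transpose G ** R"
        using rots_subset_SO[OF G(1)] by (simp add: R_def SO_def matrix_mul_assoc)
      ultimately show ?thesis using rots_mult rots_transpose[OF G(1)] by blast
    qed
  qed
  from this[of UNIV Q] assms show ?thesis by simp
qed

section \<open>The tensor power representation and its generators\<close>

lemma finite_tidx: "finite (tidx n :: 'n::finite list set)"
  using finite_lists_length_eq[of "UNIV :: 'n set" n] by (simp add: tidx_def)

lemma tidx_nonempty: "tidx n \<noteq> {}"
  by (auto simp: tidx_def intro: Ex_list_of_length)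

lemma length_tidx: "u \<in> tidx n \<Longrightarrow> length u = n"
  by (simp add: tidx_def)

text \<open>The matrix acting on tensor factor \<open>p\<close> only: a vector is given by its
  coordinates on index lists, and factor \<open>p\<close> is list position \<open>p\<close>.\<close>

definition site_op :: "nat \<Rightarrow> real^'n^'n \<Rightarrow> ('n::finite list \<Rightarrow> real) \<Rightarrow> 'n list \<Rightarrow> real" where
  "site_op p X x u = (\<Sum>m\<in>UNIV. X $ (u ! p) $ m * x (u[p := m]))"

text \<open>The Lie algebra action on the tensor power, by the Leibniz rule. The degree is read off
  from the list, so one operator serves all degrees.\<close>

definition deriv_op :: "real^'n^'n \<Rightarrow> ('n::finite list \<Rightarrow> real) \<Rightarrow> 'n list \<Rightarrow> real" where
  "deriv_op X x u = (\<Sum>p<length u. site_op p X x u)"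

lemma site_op_same:
  assumes "p < length u"
  shows "site_op p X (site_op p Y x) u = site_op p (X ** Y) x u"
proof -
  have "site_op p X (site_op p Y x) u = (\<Sum>m\<in>UNIV. \<Sum>k\<in>UNIV. X $ (u ! p) $ m * Y $ m $ k * x (u[p := k]))"
    using assms by (simp add: site_op_def sum_distrib_left mult.assoc)
  also have "\<dots> = (\<Sum>k\<in>UNIV. \<Sum>m\<in>UNIV. X $ (u ! p) $ m * Y $ m $ k * x (u[p := k]))"
    by (rule sum.swap)
  finally show ?thesis
    by (simp add: site_op_def matrix_matrix_mult_def sum_distrib_right)
qed

lemma site_op_commute:
  assumes "p \<noteq> q"
  shows "site_op p X (site_op q Y x) u = site_op q Y (site_op p X x) u"
proof -
  have "site_op p X (site_op q Y x) u =
      (\<Sum>m\<in>UNIV. \<Sum>k\<in>UNIV. X $ (u ! p) $ m * (Y $ (u ! q) $ k * x (u[p := m, q := k])))"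
    using assms by (simp add: site_op_def sum_distrib_left)
  also have "\<dots> = (\<Sum>k\<in>UNIV. \<Sum>m\<in>UNIV. X $ (u ! p) $ m * (Y $ (u ! q) $ k * x (u[p := m, q := k])))"
    by (rule sum.swap)
  finally show ?thesis
    using assms by (simp add: site_op_def sum_distrib_left list_update_swap[OF assms] mult.left_commute)
qed

lemma site_op_deriv_op: "site_op p X (deriv_op Y x) u = (\<Sum>q<length u. site_op p X (site_op q Y x) u)"
  unfolding deriv_op_def site_op_def[of p]
  by (simp add: sum_distrib_left) (rule sum.swap)

text \<open>Operators at different sites commute, so in the double sum over sites only the diagonal
  survives, where they compose like matrices.\<close>

lemma deriv_op_bracket:
  "deriv_op X (deriv_op Y x) u - deriv_op Y (deriv_op X x) u = deriv_op (X ** Y - Y ** X) x u"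
proof -
  let ?n = "length u"
  have site_diff: "site_op p A x u - site_op p B x u = site_op p (A - B) x u" for p and A B :: "real^'a^'a"
    by (simp add: site_op_def sum_subtractf algebra_simps)
  have "deriv_op X (deriv_op Y x) u - deriv_op Y (deriv_op X x) u =
     (\<Sum>p<?n. \<Sum>q<?n. site_op p X (site_op q Y x) u) - (\<Sum>p<?n. \<Sum>q<?n. site_op q Y (site_op p X x) u)"
    by (simp add: deriv_op_def[of X] deriv_op_def[of Y "deriv_op X x"] site_op_deriv_op)
       (rule sum.swap)
  also have "\<dots> = (\<Sum>p<?n. \<Sum>q<?n. if p = q then site_op p (X ** Y - Y ** X) x u else 0)"
    unfolding sum_subtractf[symmetric]
    by (intro sum.cong refl) (auto simp: site_op_same site_diff site_op_commute)
  also have "\<dots> = deriv_op (X ** Y - Y ** X) x u"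
    by (simp add: deriv_op_def)
  finally show ?thesis .
qed

lemma deriv_op_add: "deriv_op X (\<lambda>u. x u + y u) = (\<lambda>u. deriv_op X x u + deriv_op X y u)"
  and deriv_op_diff: "deriv_op X (\<lambda>u. x u - y u) = (\<lambda>u. deriv_op X x u - deriv_op X y u)"
  and deriv_op_scale: "deriv_op X (\<lambda>u. c * x u) = (\<lambda>u. c * deriv_op X x u)"
  and deriv_op_minus: "deriv_op X (\<lambda>u. - x u) = (\<lambda>u. - deriv_op X x u)"
  by (simp_all add: fun_eq_iff deriv_op_def site_op_def sum.distrib sum_subtractf sum_negf
      sum_distrib_left distrib_left right_diff_distrib mult.left_commute)

lemma deriv_op_sum: "deriv_op X (\<lambda>u. \<Sum>k\<in>S. f k u) = (\<lambda>u. \<Sum>k\<in>S. deriv_op X (f k) u)"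
proof
  fix u
  have "deriv_op X (\<lambda>u. \<Sum>k\<in>S. f k u) u = (\<Sum>p<length u. \<Sum>k\<in>S. site_op p X (f k) u)"
    unfolding deriv_op_def site_op_def by (simp add: sum_distrib_left sum.swap[of _ S])
  also have "\<dots> = (\<Sum>k\<in>S. deriv_op X (f k) u)"
    unfolding deriv_op_def by (rule sum.swap)
  finally show "deriv_op X (\<lambda>u. \<Sum>k\<in>S. f k u) u = (\<Sum>k\<in>S. deriv_op X (f k) u)" .
qed

lemma deriv_op_matrix_add: "deriv_op (X + Y) x u = deriv_op X x u + deriv_op Y x u"
  and deriv_op_matrix_diff: "deriv_op (X - Y) x u = deriv_op X x u - deriv_op Y x u"
  and deriv_op_matrix_minus: "deriv_op (- X) x u = - deriv_op X x u"
  and deriv_op_matrix_0: "deriv_op 0 x u = 0"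
  by (simp_all add: deriv_op_def site_op_def sum.distrib sum_subtractf sum_negf algebra_simps)

lemma ip_site_op:
  assumes "p < n"
  shows "ip (tidx n) (site_op p X x) y = ip (tidx n) x (site_op p (transpose X) y)"
proof -
  have "ip (tidx n) (site_op p X x) y =
      (\<Sum>(u, m)\<in>tidx n \<times> UNIV. X $ (u ! p) $ m * x (u[p := m]) * y u)"
    by (simp add: ip_def site_op_def sum_distrib_right sum.cartesian_product)
  also have "\<dots> = (\<Sum>(u, m)\<in>tidx n \<times> UNIV. x u * (transpose X $ (u ! p) $ m * y (u[p := m])))"
    \<comment> \<open>Exchanging the entry of \<open>u\<close> at position \<open>p\<close> with
      \<open>m\<close> is an involution on the summation range; it turns the matrix entry into that
      of the transpose.\<close>
    by (rule sum.reindex_bij_witness[of _ "\<lambda>(u, m). (u[p := m], u ! p)" "\<lambda>(u, m). (u[p := m], u ! p)"])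
      (use assms in \<open>auto simp: tidx_def transpose_def\<close>)
  finally show ?thesis
    by (simp add: ip_def site_op_def sum_distrib_left sum.cartesian_product)
qed

lemma ip_deriv_op: "ip (tidx n) (deriv_op X x) y = ip (tidx n) x (deriv_op (transpose X) y)"
proof -
  have "ip (tidx n) (deriv_op X x) y = ip (tidx n) (\<lambda>u. \<Sum>p<n. site_op p X x u) y"
    by (intro ip_cong) (auto simp: deriv_op_def length_tidx)
  also have "\<dots> = ip (tidx n) x (\<lambda>u. \<Sum>p<n. site_op p (transpose X) y u)"
    by (simp add: ip_sum_left ip_sum_right ip_site_op)
  also have "\<dots> = ip (tidx n) x (deriv_op (transpose X) y)"
    by (intro ip_cong) (auto simp: deriv_op_def length_tidx)
  finally show ?thesis .
qed

lemma ip_deriv_op_skew: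
  "transpose X = - X \<Longrightarrow> ip (tidx n) (deriv_op X x) y = - ip (tidx n) x (deriv_op X y)"
  by (simp add: ip_deriv_op deriv_op_matrix_minus[abs_def] ip_minus_right)

abbreviation rot_gen :: "'n::finite \<Rightarrow> 'n \<Rightarrow> ('n list \<Rightarrow> real) \<Rightarrow> 'n list \<Rightarrow> real" where
  "rot_gen a b \<equiv> deriv_op (Emat a b)"

lemmas rot_gen_skew = ip_deriv_op_skew[OF transpose_Emat]

lemma rot_gen_swap: "rot_gen b a x = (\<lambda>u. - rot_gen a b x u)"
  by (simp add: fun_eq_iff Emat_swap[of b a] deriv_op_matrix_minus)

lemma rot_gen_self: "rot_gen a a x = (\<lambda>u. 0)"
  by (simp add: fun_eq_iff Emat_self deriv_op_matrix_0)

lemma rot_gen_bracket: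
  "rot_gen a b (rot_gen c d x) u - rot_gen c d (rot_gen a b x) u =
     (if b = c then rot_gen a d x u else 0) - (if a = c then rot_gen b d x u else 0)
   - (if b = d then rot_gen a c x u else 0) + (if a = d then rot_gen b c x u else 0)"
  unfolding deriv_op_bracket Emat_bracket
  by (simp add: deriv_op_matrix_add deriv_op_matrix_diff deriv_op_matrix_0)

text \<open>Each site operator is a contraction, because the Gram matrix of \<open>Emat a b\<close>
  is the coordinate projection onto the span of \<open>a\<close> and \<open>b\<close>.
  Cauchy-Schwarz over the \<open>n\<close> sites then bounds the norm of the sum by
  \<open>n\<close>.\<close>

lemma rot_gen_norm_le: 
  assumes "a \<noteq> b"
  shows "ip (tidx n) (rot_gen a b x) (rot_gen a b x) \<le> (real n)\<^sup>2 * ip (tidx n) x x"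
proof -
  let ?I = "tidx n"
  have site: "ip ?I (site_op p (Emat a b) x) (site_op p (Emat a b) x) \<le> ip ?I x x" if "p < n" for p
  proof -
    have EE: "(transpose (Emat a b) ** Emat a b) $ i $ j = (if i = j then (if i = a \<or> i = b then 1 else 0) else 0)" for i j
      unfolding transpose_Emat Emat_swap[of b a, symmetric] Emat_mult_nth using assms
      by (cases "i = a"; cases "i = b"; cases "j = a"; cases "j = b"; simp add: Emat_nth)
    have "ip ?I (site_op p (Emat a b) x) (site_op p (Emat a b) x)
        = ip ?I x (site_op p (transpose (Emat a b) ** Emat a b) x)"
      unfolding ip_site_op[OF that] by (intro ip_cong site_op_same) (use that in \<open>auto simp: length_tidx\<close>)
    also have "\<dots> = ip ?I x (\<lambda>u. if u ! p = a \<or> u ! p = b then x u else 0)"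
      by (intro ip_cong) (simp_all add: site_op_def EE if_distrib[of "\<lambda>c. c * _"] cong: if_cong)
    also have "\<dots> \<le> ip ?I x x"
      unfolding ip_def by (intro sum_mono) auto
    finally show ?thesis .
  qed
  have "ip ?I (rot_gen a b x) (rot_gen a b x) = (\<Sum>u\<in>?I. (\<Sum>p<n. site_op p (Emat a b) x u)\<^sup>2)"
    by (simp add: ip_def deriv_op_def length_tidx power2_eq_square)
  also have "\<dots> \<le> (\<Sum>u\<in>?I. real n * (\<Sum>p<n. (site_op p (Emat a b) x u)\<^sup>2))"
  proof (intro sum_mono)
    fix u
    show "(\<Sum>p<n. site_op p (Emat a b) x u)\<^sup>2 \<le> real n * (\<Sum>p<n. (site_op p (Emat a b) x u)\<^sup>2)"
      using Cauchy_Schwarz_ineq_sum[of "\<lambda>_. 1" "\<lambda>p. site_op p (Emat a b) x u" "{..<n}"] by simp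
  qed
  also have "\<dots> = real n * (\<Sum>p<n. ip ?I (site_op p (Emat a b) x) (site_op p (Emat a b) x))"
    unfolding sum_distrib_left[symmetric] sum.swap[of _ "{..<n}" ?I] by (simp add: ip_def power2_eq_square)
  also have "\<dots> \<le> real n * (\<Sum>p<n. ip ?I x x)"
    by (intro mult_left_mono sum_mono site) auto
  finally show ?thesis by (simp add: power2_eq_square mult.assoc)
qed

lemma deriv_op_DERIV:
  assumes "\<And>v. length v = length u \<Longrightarrow> ((\<lambda>s. f s v) has_real_derivative f' v) (at \<theta>)"
  shows "((\<lambda>s. deriv_op X (f s) u) has_real_derivative deriv_op X f' u) (at \<theta>)"
  unfolding deriv_op_def site_op_def
  by (intro DERIV_sum DERIV_cmult assms) simp

text \<open>Energy conservation: skewness makes the squared norm of a solution constant. Applied to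
  a difference of two solutions, this turns identities between generators into identities between
  rotations.\<close>

lemma skew_flow_unique:
  assumes skew: "transpose X = - X"
    and deriv: "\<And>s v. length v = length u \<Longrightarrow> ((\<lambda>s. w s v) has_real_derivative deriv_op X (w s) v) (at s)"
    and init: "\<And>v. length v = length u \<Longrightarrow> w 0 v = 0"
  shows "w \<theta> u = 0"
proof -
  let ?I = "tidx (length u)"
  have "((\<lambda>s. ip ?I (w s) (w s)) has_real_derivative 0) (at s)" for s
  proof -
    have "((\<lambda>s. ip ?I (w s) (w s)) has_real_derivative
         (\<Sum>v\<in>?I. deriv_op X (w s) v * w s v + deriv_op X (w s) v * w s v)) (at s)"
      unfolding ip_def by (intro DERIV_sum DERIV_mult deriv) (simp_all add: length_tidx)
    moreover have "(\<Sum>v\<in>?I. deriv_op X (w s) v * w s v + deriv_op X (w s) v * w s v) = 2 * ip ?I (deriv_op X (w s)) (w s)"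
      by (simp add: ip_def sum_distrib_left mult_ac)
    moreover have "ip ?I (deriv_op X (w s)) (w s) = 0"
      using ip_deriv_op_skew[OF skew, of "length u" "w s" "w s"] ip_commute[of ?I "w s"] by simp
    ultimately show ?thesis by simp
  qed
  then have "ip ?I (w \<theta>) (w \<theta>) = ip ?I (w 0) (w 0)"
    by (intro DERIV_isconst_all allI)
  also have "\<dots> = 0" by (simp add: init ip_def length_tidx)
  finally have "\<forall>v\<in>?I. w \<theta> v = 0" by (simp add: ip_eq_0_iff finite_tidx)
  then show ?thesis by (simp add: tidx_def)
qed

section \<open>Tensor powers as operators and their differential equation\<close>

definition tens_op :: "real^'n^'n \<Rightarrow> ('n::finite list \<Rightarrow> real) \<Rightarrow> 'n list \<Rightarrow> real" where
  "tens_op Q x u = (\<Sum>v\<in>tidx (length u). tens_pow Q (length u) u v * x v)"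

lemma tens_op_diff: "tens_op Q (\<lambda>u. x u - y u) = (\<lambda>u. tens_op Q x u - tens_op Q y u)"
  by (simp add: fun_eq_iff tens_op_def sum_subtractf right_diff_distrib)

lemma tens_op_cong: "(\<And>v. length v = length u \<Longrightarrow> x v = y v) \<Longrightarrow> tens_op Q x u = tens_op Q y u"
  by (simp add: tens_op_def length_tidx)

lemma tens_pow_transpose: "tens_pow (transpose Q) n u v = tens_pow Q n v u"
  by (simp add: tens_pow_def transpose_def)

lemma ip_tens_op: "ip (tidx n) (tens_op Q x) y = ip (tidx n) x (tens_op (transpose Q) y)"
proof -
  have "ip (tidx n) (tens_op Q x) y = (\<Sum>u\<in>tidx n. \<Sum>v\<in>tidx n. tens_pow Q n u v * x v * y u)"
    by (simp add: ip_def tens_op_def length_tidx sum_distrib_right)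
  also have "\<dots> = (\<Sum>v\<in>tidx n. \<Sum>u\<in>tidx n. tens_pow Q n u v * x v * y u)"
    by (rule sum.swap)
  also have "\<dots> = ip (tidx n) x (tens_op (transpose Q) y)"
    by (simp add: ip_def tens_op_def length_tidx sum_distrib_left tens_pow_transpose mult_ac)
  finally show ?thesis .
qed

lemma tidx_0: "tidx 0 = {[]}"
  by (auto simp: tidx_def)

lemma sum_tidx_Suc: "(\<Sum>v\<in>tidx (Suc n). f v) = (\<Sum>m\<in>UNIV. \<Sum>v\<in>tidx n. f (m # v))"
proof -
  have "(\<Sum>v\<in>tidx (Suc n). f v) = (\<Sum>(m, v)\<in>UNIV \<times> tidx n. f (m # v))"
    by (rule sum.reindex_bij_witness[of _ "\<lambda>(m, v). m # v" "\<lambda>v. (hd v, tl v)"])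
      (auto simp: tidx_def length_Suc_conv)
  then show ?thesis by (simp add: sum.cartesian_product)
qed

lemma tens_pow_Cons: "tens_pow Q (Suc n) (i # u) (j # v) = Q $ i $ j * tens_pow Q n u v"
  unfolding tens_pow_def prod.lessThan_Suc_shift by simp

lemma tens_pow_mult:
  "length u = n \<Longrightarrow> length w = n \<Longrightarrow>
    tens_pow (A ** B) n u w = (\<Sum>v\<in>tidx n. tens_pow A n u v * tens_pow B n v w)"
proof (induction n arbitrary: u w)
  case 0
  then show ?case by (simp add: tens_pow_def tidx_0)
next
  case (Suc n)
  then obtain i u' j w' where uw: "u = i # u'" "w = j # w'" "length u' = n" "length w' = n"
    by (metis length_Suc_conv)
  show ?case
    unfolding uw tens_pow_Cons sum_tidx_Suc Suc.IH[OF uw(3,4)]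
    unfolding matrix_matrix_mult_def vec_lambda_beta sum_product
    by (intro sum.cong refl) (simp only: mult_ac)
qed

lemma tens_pow_one: "length u = n \<Longrightarrow> length v = n \<Longrightarrow> tens_pow (mat 1) n u v = (if u = v then 1 else 0)"
proof (induction n arbitrary: u v)
  case (Suc n)
  then obtain i u' j w' where "u = i # u'" "v = j # w'" "length u' = n" "length w' = n"
    by (metis length_Suc_conv)
  with Suc.IH[of u' w'] show ?case
    by (simp add: tens_pow_Cons mat_def)
qed (simp add: tens_pow_def)

lemma tens_op_mult: "tens_op A (tens_op B x) u = tens_op (A ** B) x u"
proof -
  let ?n = "length u"
  have "tens_op A (tens_op B x) u =
      (\<Sum>v\<in>tidx ?n. \<Sum>w\<in>tidx ?n. tens_pow A ?n u v * tens_pow B ?n v w * x w)"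
    by (simp add: tens_op_def length_tidx sum_distrib_left mult.assoc)
  also have "\<dots> = (\<Sum>w\<in>tidx ?n. \<Sum>v\<in>tidx ?n. tens_pow A ?n u v * tens_pow B ?n v w * x w)"
    by (rule sum.swap)
  also have "\<dots> = tens_op (A ** B) x u"
    by (simp add: tens_op_def length_tidx tens_pow_mult sum_distrib_right)
  finally show ?thesis .
qed

lemma tens_op_one: "tens_op (mat 1) x u = x u"
proof -
  have "tens_op (mat 1) x u = (\<Sum>v\<in>tidx (length u). if u = v then x v else 0)"
    unfolding tens_op_def by (intro sum.cong) (auto simp: tens_pow_one length_tidx)
  then show ?thesis by (simp add: finite_tidx) (simp add: tidx_def)
qed

text \<open>Product rule: differentiating factor \<open>p\<close> of a tensor entry replaces row
  \<open>u ! p\<close> by its image under \<open>X\<close>, which is the site operator at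
  \<open>p\<close>. Hence the tensor power of a flow is the flow of the Lie algebra action.\<close>

lemma tens_op_DERIV:
  assumes R: "\<And>i j. ((\<lambda>s. R s $ i $ j) has_real_derivative (X ** R \<theta>) $ i $ j) (at \<theta>)"
  shows "((\<lambda>s. tens_op (R s) x u) has_real_derivative deriv_op X (tens_op (R \<theta>) x) u) (at \<theta>)"
proof -
  let ?n = "length u"
  have tp: "((\<lambda>s. tens_pow (R s) ?n u v) has_real_derivative
      (\<Sum>p<?n. \<Sum>m\<in>UNIV. X $ (u ! p) $ m * tens_pow (R \<theta>) ?n (u[p := m]) v)) (at \<theta>)" for v
  proof -
    have upd: "tens_pow (R \<theta>) ?n (u[p := m]) v
        = R \<theta> $ m $ (v ! p) * (\<Prod>k\<in>{..<?n} - {p}. R \<theta> $ (u ! k) $ (v ! k))" if "p < ?n" for p m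
    proof -
      have "tens_pow (R \<theta>) ?n (u[p := m]) v = R \<theta> $ (u[p := m] ! p) $ (v ! p)
          * (\<Prod>k\<in>{..<?n} - {p}. R \<theta> $ (u[p := m] ! k) $ (v ! k))"
        unfolding tens_pow_def using that by (intro prod.remove) auto
      also have "(\<Prod>k\<in>{..<?n} - {p}. R \<theta> $ (u[p := m] ! k) $ (v ! k)) = (\<Prod>k\<in>{..<?n} - {p}. R \<theta> $ (u ! k) $ (v ! k))"
        by (intro prod.cong) auto
      finally show ?thesis using that by simp
    qed
    have "((\<lambda>s. tens_pow (R s) ?n u v) has_real_derivative
      (\<Sum>p<?n. (X ** R \<theta>) $ (u ! p) $ (v ! p) * (\<Prod>k\<in>{..<?n} - {p}. R \<theta> $ (u ! k) $ (v ! k)))) (at \<theta>)"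
      unfolding tens_pow_def by (rule has_field_derivative_prod[OF R])
    then show ?thesis
      by (simp add: upd matrix_matrix_mult_def sum_distrib_right mult.assoc)
  qed
  have "((\<lambda>s. tens_op (R s) x u) has_real_derivative
      (\<Sum>v\<in>tidx ?n. (\<Sum>p<?n. \<Sum>m\<in>UNIV. X $ (u ! p) $ m * tens_pow (R \<theta>) ?n (u[p := m]) v) * x v)) (at \<theta>)"
    unfolding tens_op_def by (intro DERIV_sum DERIV_cmult_right tp)
  moreover have "(\<Sum>v\<in>tidx ?n. (\<Sum>p<?n. \<Sum>m\<in>UNIV. X $ (u ! p) $ m * tens_pow (R \<theta>) ?n (u[p := m]) v) * x v)
      = deriv_op X (tens_op (R \<theta>) x) u"
    unfolding deriv_op_def site_op_def tens_op_def
    by (simp add: sum_distrib_left sum_distrib_right mult.assoc sum.swap[of _ "tidx (length u)"])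
  ultimately show ?thesis by simp
qed

lemma rot_DERIV:
  assumes "a \<noteq> b"
  shows "((\<lambda>s. rot a b s $ i $ j) has_real_derivative (Emat a b ** rot a b \<theta>) $ i $ j) (at \<theta>)"
proof -
  have "((\<lambda>s. rot a b s $ i $ j) has_real_derivative
      cos \<theta> * Emat a b $ i $ j + sin \<theta> * (Emat a b ** Emat a b) $ i $ j) (at \<theta>)"
    unfolding rot_def by (auto intro!: derivative_eq_intros)
  moreover have "Emat a b ** rot a b \<theta> = cos \<theta> *\<^sub>R Emat a b + sin \<theta> *\<^sub>R (Emat a b ** Emat a b)"
    unfolding rot_def using assms
    by (simp add: matrix_mult_add_right matrix_mult_diff_right matrix_mult_scaleR Emat_cube scaleR_left_diff_distrib)
  ultimately show ?thesis by simp
qed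

lemmas tens_op_rot_DERIV = tens_op_DERIV[OF rot_DERIV]

section \<open>The Casimir operator\<close>

text \<open>The convexity hypothesis is the arithmetic-geometric form of
  \<open>a (n+1)^2 \<le> a n * a (n+2)\<close>, so successive ratios increase. A first ratio above
  \<open>r\<close> would force growth at a rate \<open>\<rho> > r\<close>, against the exponential
  bound.\<close>

lemma ratio_le_of_log_convex:
  fixes a :: "nat \<Rightarrow> real"
  assumes nn: "\<And>n. 0 \<le> a n"
    and conv: "\<And>s n. 0 < s \<Longrightarrow> 2 * s * a (Suc n) \<le> s\<^sup>2 * a n + a (Suc (Suc n))"
    and bnd: "\<And>n. a n \<le> M * r ^ n" and r: "0 < r"
  shows "a 1 \<le> r * a 0"
proof (rule ccontr)
  assume "\<not> ?thesis"
  then have gt: "r * a 0 < a 1" by simp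
  then have a1: "0 < a 1" using nn[of 0] r by (meson le_less_trans mult_nonneg_nonneg less_imp_le)
  \<comment> \<open>For \<open>a 0 = 0\<close> any rate above \<open>r\<close> serves; otherwise the
    first ratio itself is taken.\<close>
  obtain \<rho> where \<rho>: "r < \<rho>" "\<rho> * a 0 \<le> a 1"
  proof (cases "a 0 = 0")
    case True
    then show ?thesis using that[of "r + 1"] a1 by simp
  next
    case False
    then have "0 < a 0" using nn[of 0] by simp
    then show ?thesis using that[of "a 1 / a 0"] gt by (simp add: field_simps)
  qed
  have step: "\<rho> * a n \<le> a (Suc n)" for n
  proof (induction n)
    case (Suc n)
    have "2 * \<rho> * a (Suc n) \<le> \<rho> * (\<rho> * a n) + a (Suc (Suc n))"
      using conv[of \<rho> n] \<rho>(1) r by (simp add: power2_eq_square mult.assoc)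
    moreover have "\<rho> * (\<rho> * a n) \<le> \<rho> * a (Suc n)"
      using Suc \<rho>(1) r by (intro mult_left_mono) auto
    ultimately show ?case by simp
  qed (use \<rho> in simp)
  have lower: "\<rho> ^ n * a 1 \<le> a (Suc n)" for n
  proof (induction n)
    case (Suc n)
    have "\<rho> ^ Suc n * a 1 = \<rho> * (\<rho> ^ n * a 1)" by simp
    also have "\<dots> \<le> \<rho> * a (Suc n)" using Suc \<rho>(1) r by (intro mult_left_mono) auto
    also have "\<dots> \<le> a (Suc (Suc n))" by (rule step)
    finally show ?case .
  qed simp
  obtain n where n: "M * r / a 1 < (\<rho> / r) ^ n"
    using real_arch_pow[of "\<rho> / r"] \<rho>(1) r by auto
  have "\<rho> ^ n * a 1 \<le> M * r * r ^ n" using lower[of n] bnd[of "Suc n"] by (simp add: mult.assoc)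
  then have "\<rho> ^ n / r ^ n \<le> M * r / a 1" using a1 r by (simp add: field_simps)
  then show False using n by (simp add: power_divide)
qed

context
  fixes a b j :: "'n::finite" and n :: nat
  assumes distinct: "a \<noteq> b" "a \<noteq> j" "b \<noteq> j"
begin

text \<open>The bilinear form of the operator
  \<open>- L\<^sub>a\<^sub>j\<^sup>2 - L\<^sub>b\<^sub>j\<^sup>2\<close>, which is positive but may
  be degenerate.\<close>

definition pair_form :: "('n list \<Rightarrow> real) \<Rightarrow> ('n list \<Rightarrow> real) \<Rightarrow> real" where
  "pair_form x y = ip (tidx n) (rot_gen a j x) (rot_gen a j y) + ip (tidx n) (rot_gen b j x) (rot_gen b j y)"

text \<open>Bracketing with \<open>L\<^sub>a\<^sub>b\<close> rotates the pair
  \<open>L\<^sub>a\<^sub>j\<close>, \<open>L\<^sub>b\<^sub>j\<close> infinitesimally, which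
  preserves its sum of squares: the two bracket terms cancel.\<close>

lemma pair_form_skew: "pair_form (rot_gen a b x) y = - pair_form x (rot_gen a b y)"
proof -
  have 1: "rot_gen a j (rot_gen a b x) = (\<lambda>u. rot_gen a b (rot_gen a j x) u + rot_gen b j x u)" for x
    using rot_gen_bracket[of a b a j x] distinct by (auto simp: fun_eq_iff algebra_simps)
  have 2: "rot_gen b j (rot_gen a b x) = (\<lambda>u. rot_gen a b (rot_gen b j x) u - rot_gen a j x u)" for x
    using rot_gen_bracket[of a b b j x] distinct by (auto simp: fun_eq_iff algebra_simps)
  show ?thesis
    unfolding pair_form_def 1 2 ip_linear rot_gen_skew[of n a b]
    by (simp add: algebra_simps)
qed

lemma pair_form_nonneg: "0 \<le> pair_form x x"
  by (simp add: pair_form_def ip_nonneg)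

lemma pair_form_le: "pair_form x x \<le> 2 * (real n)\<^sup>2 * ip (tidx n) x x"
  unfolding pair_form_def using rot_gen_norm_le[of a j n x] rot_gen_norm_le[of b j n x] distinct by simp

text \<open>The rotation generator is skew for this form as well, so by log-convexity its norm with
  respect to it cannot exceed its Euclidean norm (Reid's inequality).\<close>

lemma pair_form_rot_gen_le:
  assumes "0 < n"
  shows "pair_form (rot_gen a b x) (rot_gen a b x) \<le> (real n)\<^sup>2 * pair_form x x"
proof -
  define y where "y k = (rot_gen a b ^^ k) x" for k
  have ySuc: "y (Suc k) = rot_gen a b (y k)" for k by (simp add: y_def)
  have "pair_form (y 1) (y 1) \<le> (real n)\<^sup>2 * pair_form (y 0) (y 0)"
  proof (rule ratio_le_of_log_convex[where a = "\<lambda>k. pair_form (y k) (y k)" and M = "2 * (real n)\<^sup>2 * ip (tidx n) x x"])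
    fix s :: real and k assume "0 < s"
    \<comment> \<open>Log-convexity is nonnegativity of the form at
      \<open>s * y k + y (k+2)\<close>: by skewness each cross term equals minus the form at
      \<open>y (k+1)\<close>.\<close>
    have "pair_form (\<lambda>u. s * y k u + y (Suc (Suc k)) u) (\<lambda>u. s * y k u + y (Suc (Suc k)) u)
        = s\<^sup>2 * pair_form (y k) (y k) + s * pair_form (y k) (y (Suc (Suc k)))
          + s * pair_form (y (Suc (Suc k))) (y k) + pair_form (y (Suc (Suc k))) (y (Suc (Suc k)))"
      unfolding pair_form_def deriv_op_add deriv_op_scale ip_linear
      by (simp add: power2_eq_square algebra_simps)
    moreover have "pair_form (y (Suc (Suc k))) (y k) = - pair_form (y (Suc k)) (y (Suc k))"
      by (simp only: ySuc[of "Suc k"] pair_form_skew) (simp only: ySuc)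
    moreover have "pair_form (y k) (y (Suc (Suc k))) = - pair_form (y (Suc k)) (y (Suc k))"
      using pair_form_skew[of "y k" "y (Suc k)"] by (simp add: ySuc)
    ultimately show "2 * s * pair_form (y (Suc k)) (y (Suc k))
        \<le> s\<^sup>2 * pair_form (y k) (y k) + pair_form (y (Suc (Suc k))) (y (Suc (Suc k)))"
      using pair_form_nonneg[of "\<lambda>u. s * y k u + y (Suc (Suc k)) u"] by (simp add: algebra_simps)
  next
    fix k
    \<comment> \<open>The exponential bound comes from iterating the Euclidean norm estimate, then
      comparing the form with the Euclidean one by \<open>pair_form_le\<close>.\<close>
    have "ip (tidx n) (y k) (y k) \<le> ((real n)\<^sup>2) ^ k * ip (tidx n) x x"
    proof (induction k)
      case (Suc k)
      have "ip (tidx n) (y (Suc k)) (y (Suc k)) \<le> (real n)\<^sup>2 * ip (tidx n) (y k) (y k)"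
        unfolding ySuc by (rule rot_gen_norm_le[OF distinct(1)])
      also have "\<dots> \<le> (real n)\<^sup>2 * (((real n)\<^sup>2) ^ k * ip (tidx n) x x)"
        by (intro mult_left_mono Suc) auto
      finally show ?case by (simp add: mult.assoc)
    qed (simp add: y_def)
    then have "2 * (real n)\<^sup>2 * ip (tidx n) (y k) (y k) \<le> 2 * (real n)\<^sup>2 * (((real n)\<^sup>2) ^ k * ip (tidx n) x x)"
      by (intro mult_left_mono) auto
    then show "pair_form (y k) (y k) \<le> 2 * (real n)\<^sup>2 * ip (tidx n) x x * ((real n)\<^sup>2) ^ k"
      using pair_form_le[of "y k"] by (simp add: mult_ac)
  qed (use assms in \<open>auto simp: pair_form_nonneg\<close>)
  then show ?thesis by (simp add: y_def)
qed

text \<open>An uncertainty relation for the commutator \<open>[L\<^sub>a\<^sub>j, L\<^sub>b\<^sub>j] = - L\<^sub>a\<^sub>b\<close>.\<close>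

lemma rot_gen_uncertainty:
  assumes "0 < n"
  shows "ip (tidx n) (rot_gen a b x) (rot_gen a b x) \<le> real n * pair_form x x"
proof -
  let ?I = "tidx n"
  define y where "y = rot_gen a b x"
  have y_eq: "y = (\<lambda>u. rot_gen b j (rot_gen a j x) u - rot_gen a j (rot_gen b j x) u)"
    using rot_gen_bracket[of a j b j x] distinct by (auto simp: y_def fun_eq_iff algebra_simps)
  have "ip ?I y y = ip ?I (\<lambda>u. rot_gen b j (rot_gen a j x) u - rot_gen a j (rot_gen b j x) u) y"
    using y_eq by metis
  then have yy: "ip ?I y y = ip ?I (rot_gen b j x) (rot_gen a j y) - ip ?I (rot_gen a j x) (rot_gen b j y)"
    unfolding ip_linear rot_gen_skew by simp
  \<comment> \<open>Squares with weight \<open>n\<close> on the \<open>x\<close> side. The weight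
    balances the two resulting terms, since the form at \<open>y\<close> is at most
    \<open>n\<^sup>2\<close> times the form at \<open>x\<close>.\<close>
  have 1: "0 \<le> (real n)\<^sup>2 * ip ?I (rot_gen a j x) (rot_gen a j x) + 2 * real n * ip ?I (rot_gen a j x) (rot_gen b j y)
      + ip ?I (rot_gen b j y) (rot_gen b j y)"
    using ip_nonneg[of ?I "\<lambda>u. real n * rot_gen a j x u + rot_gen b j y u"]
    unfolding ip_linear ip_commute[of ?I "rot_gen b j y" "rot_gen a j x"]
    by (simp add: power2_eq_square algebra_simps)
  have 2: "0 \<le> (real n)\<^sup>2 * ip ?I (rot_gen b j x) (rot_gen b j x) - 2 * real n * ip ?I (rot_gen b j x) (rot_gen a j y)
      + ip ?I (rot_gen a j y) (rot_gen a j y)"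
    using ip_nonneg[of ?I "\<lambda>u. real n * rot_gen b j x u - rot_gen a j y u"]
    unfolding ip_linear ip_commute[of ?I "rot_gen a j y" "rot_gen b j x"]
    by (simp add: power2_eq_square algebra_simps)
  have "2 * real n * ip ?I y y \<le> (real n)\<^sup>2 * pair_form x x + pair_form y y"
    using 1 2 unfolding yy pair_form_def by (simp add: algebra_simps)
  also have "\<dots> \<le> 2 * real n * (real n * pair_form x x)"
    using pair_form_rot_gen_le[OF assms, of x] by (simp add: y_def power2_eq_square)
  finally show ?thesis using assms by (simp add: y_def)
qed

end

text \<open>Ordered pairs count each plane twice, so this is twice the operator \<open>C\<close> of
  the opening text; hence the factors 2 in the bounds below.\<close>

definition casimir :: "('n::finite list \<Rightarrow> real) \<Rightarrow> 'n list \<Rightarrow> real" where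
  "casimir x u = - (\<Sum>c\<in>UNIV. \<Sum>d\<in>UNIV. rot_gen c d (rot_gen c d x) u)"

lemma ip_casimir: "ip (tidx n) (casimir x) y = (\<Sum>c\<in>UNIV. \<Sum>d\<in>UNIV. ip (tidx n) (rot_gen c d x) (rot_gen c d y))"
  unfolding casimir_def ip_minus_left ip_sum_left rot_gen_skew by (simp add: sum_negf)

text \<open>Only planes meeting \<open>a\<close> or \<open>b\<close> are kept: the plane of
  \<open>a\<close> and \<open>b\<close> itself, and for each of the remaining N - 2 indices
  \<open>j\<close> the two planes joining it to \<open>a\<close> and \<open>b\<close>, which
  together dominate \<open>1 / n\<close> of the first by the uncertainty relation.\<close>

lemma casimir_lower_bound:
  fixes x :: "'n::finite list \<Rightarrow> real"
  assumes ab: "a \<noteq> b" and n: "0 < n"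
  shows "2 * (1 + (real CARD('n) - 2) / real n) * ip (tidx n) (rot_gen a b x) (rot_gen a b x)
     \<le> ip (tidx n) (casimir x) x"
proof -
  let ?R = "- {a, b}"
  define q where "q c d = ip (tidx n) (rot_gen c d x) (rot_gen c d x)" for c d
  have q_nn: "0 \<le> q c d" for c d by (simp add: q_def ip_nonneg)
  have q_sym: "q c d = q d c" for c d unfolding q_def by (subst (1 2) rot_gen_swap) (simp add: ip_linear)
  have split: "(\<Sum>c\<in>UNIV. f c) = f a + f b + (\<Sum>c\<in>?R. f c)" for f :: "'n \<Rightarrow> real"
  proof -
    have "UNIV = insert a (insert b ?R)" by auto
    then have "(\<Sum>c\<in>UNIV. f c) = (\<Sum>c\<in>insert a (insert b ?R). f c)" by simp
    then show ?thesis using ab by (simp add: add.assoc)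
  qed
  have card: "real (card ?R) = real CARD('n) - 2"
    using ab card_mono[of UNIV "{a, b}"] by (simp add: Compl_eq_Diff_UNIV card_Diff_subset of_nat_diff)
  have "(real CARD('n) - 2) * q a b = (\<Sum>j\<in>?R. q a b)" by (simp add: card)
  also have "\<dots> \<le> (\<Sum>j\<in>?R. real n * (q a j + q b j))"
    using rot_gen_uncertainty[OF ab _ _ n, of _ x]
    by (intro sum_mono) (auto simp: q_def pair_form_def[OF ab])
  also have "\<dots> = (\<Sum>j\<in>?R. q a j + q b j) * real n"
    by (simp only: sum_distrib_left mult.commute[of _ "real n"])
  finally have unc: "(real CARD('n) - 2) / real n * q a b \<le> (\<Sum>j\<in>?R. q a j + q b j)"
    using n by (simp add: pos_divide_le_eq)
  have "2 * (q a b + (\<Sum>j\<in>?R. q a j + q b j))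
      = (q a b + (\<Sum>d\<in>?R. q a d)) + (q b a + (\<Sum>d\<in>?R. q b d)) + (\<Sum>c\<in>?R. q c a + q c b)"
  proof -
    have "(\<Sum>c\<in>?R. q c a + q c b) = (\<Sum>j\<in>?R. q a j + q b j)"
      by (intro sum.cong refl arg_cong2[of _ _ _ _ "(+)"] q_sym)
    then show ?thesis using q_sym[of b a] by (simp add: sum.distrib)
  qed
  also have "\<dots> \<le> (\<Sum>d\<in>UNIV. q a d) + (\<Sum>d\<in>UNIV. q b d) + (\<Sum>c\<in>?R. \<Sum>d\<in>UNIV. q c d)"
    by (intro add_mono sum_mono) (simp_all add: split q_nn sum_nonneg)
  also have "\<dots> = (\<Sum>c\<in>UNIV. \<Sum>d\<in>UNIV. q c d)"
    by (simp add: split[of "\<lambda>c. \<Sum>d\<in>UNIV. q c d"])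
  also have "\<dots> = ip (tidx n) (casimir x) x" by (simp add: ip_casimir q_def)
  finally have "2 * (q a b + (\<Sum>j\<in>?R. q a j + q b j)) \<le> ip (tidx n) (casimir x) x" .
  moreover have "2 * (1 + r) * q a b = 2 * (q a b + r * q a b)" for r :: real
    by (simp only: distrib_left distrib_right mult_1_right mult_1_left mult.assoc)
  ultimately show ?thesis using unc unfolding q_def[symmetric] by (smt (verit))
qed

text \<open>Moving \<open>L\<^sub>a\<^sub>b\<close> past the two factors of each summand leaves
  bracket terms \<open>B\<close>. Summed over all planes, antisymmetry reduces them to multiples of
  \<open>S a b\<close> and \<open>S b a\<close> that cancel.\<close>

lemma casimir_commute: "rot_gen a b (casimir x) u = casimir (rot_gen a b x) u"
proof -
  define B where "B c d y = (\<lambda>u. (if b = c then rot_gen a d y u else 0) - (if a = c then rot_gen b d y u else 0)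
   - (if b = d then rot_gen a c y u else 0) + (if a = d then rot_gen b c y u else 0))" for c d y
  have comm: "rot_gen a b (rot_gen c d y) = (\<lambda>u. rot_gen c d (rot_gen a b y) u + B c d y u)" for c d y
    using rot_gen_bracket[of a b c d y] by (auto simp: fun_eq_iff B_def algebra_simps)
  have gen_if: "rot_gen c d (\<lambda>u. if P then y u else 0) u = (if P then rot_gen c d y u else 0)" for c d P y
    by (auto simp: deriv_op_def site_op_def)
  have swap: "rot_gen c d (rot_gen e f x) u = - rot_gen c d (rot_gen f e x) u"
    "rot_gen c d (rot_gen e f x) u = - rot_gen d c (rot_gen e f x) u" for c d e f
    by (simp_all add: rot_gen_swap[of e f] rot_gen_swap[of d c] deriv_op_minus)
  define S where "S e f = (\<Sum>d\<in>UNIV. rot_gen e d (rot_gen f d x) u)" for e f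
  have S: "(\<Sum>c\<in>UNIV. rot_gen c e (rot_gen f c x) u) = - S e f"
    "(\<Sum>c\<in>UNIV. rot_gen e c (rot_gen c f x) u) = - S e f" for e f
    unfolding S_def sum_negf[symmetric] by (rule sum.cong[OF refl], rule swap)+
  have "rot_gen a b (casimir x) u = - (\<Sum>c\<in>UNIV. \<Sum>d\<in>UNIV. rot_gen a b (rot_gen c d (rot_gen c d x)) u)"
    unfolding casimir_def[abs_def] deriv_op_minus deriv_op_sum ..
  also have "\<dots> = casimir (rot_gen a b x) u
      - (\<Sum>c\<in>UNIV. \<Sum>d\<in>UNIV. rot_gen c d (B c d x) u + B c d (rot_gen c d x) u)"
    unfolding comm deriv_op_add casimir_def by (simp add: sum.distrib)
  \<comment> \<open>The right side lists the eight Kronecker delta terms in order, four from each of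
    the two occurrences of \<open>B\<close>.\<close>
  also have "(\<Sum>c\<in>UNIV. \<Sum>d\<in>UNIV. rot_gen c d (B c d x) u + B c d (rot_gen c d x) u) =
      S b a - S a b - (- S b a) + (- S a b) + (S a b - S b a - (- S a b) + (- S b a))"
  proof -
    have delta: "(\<Sum>c\<in>UNIV. \<Sum>d\<in>UNIV. if e = c then f c d else 0) = (\<Sum>d\<in>UNIV. f e d)"
      "(\<Sum>c\<in>UNIV. \<Sum>d\<in>UNIV. if e = d then f c d else 0) = (\<Sum>c\<in>UNIV. f c e)"
      for e :: 'a and f :: "'a \<Rightarrow> 'a \<Rightarrow> real"
    proof -
      have "(\<Sum>d\<in>UNIV. if e = c then f c d else 0) = (if e = c then \<Sum>d\<in>UNIV. f c d else 0)" for c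
        by simp
      then show "(\<Sum>c\<in>UNIV. \<Sum>d\<in>UNIV. if e = c then f c d else 0) = (\<Sum>d\<in>UNIV. f e d)"
        by simp
    qed simp
    show ?thesis
      unfolding B_def deriv_op_add deriv_op_diff gen_if sum.distrib sum_subtractf delta S S_def[symmetric] ..
  qed
  also have "\<dots> = 0" by simp
  finally show ?thesis by simp
qed

section \<open>Averages over plane rotations\<close>

lemma sum_symmetric_pairs:
  fixes f :: "'n::{finite,linorder} \<Rightarrow> 'n \<Rightarrow> real"
  assumes sym: "\<And>c d. f c d = f d c" and diag: "\<And>c. f c c = 0"
  shows "(\<Sum>c\<in>UNIV. \<Sum>d\<in>UNIV. f c d) = 2 * (\<Sum>(c, d)\<in>Epairs. f c d)"
proof -
  let ?g = "\<lambda>(c, d). f c d"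
  have "(\<Sum>c\<in>UNIV. \<Sum>d\<in>UNIV. f c d) = (\<Sum>p\<in>UNIV. ?g p)"
    by (simp add: sum.cartesian_product)
  also have "(UNIV :: ('n \<times> 'n) set) = Epairs \<union> ((\<lambda>(c, d). (d, c)) ` Epairs \<union> {(c, d). c = d})"
    by (auto simp: Epairs_def image_iff)
  also have "(\<Sum>p\<in>Epairs \<union> ((\<lambda>(c, d). (d, c)) ` Epairs \<union> {(c, d). c = d}). ?g p)
      = (\<Sum>p\<in>Epairs. ?g p) + ((\<Sum>p\<in>(\<lambda>(c, d). (d, c)) ` Epairs. ?g p) + (\<Sum>p\<in>{(c, d). c = d}. ?g p))"
    by (subst sum.union_disjoint, simp, simp, force simp: Epairs_def,
        subst sum.union_disjoint, simp, simp, force simp: Epairs_def, simp)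
  also have "(\<Sum>p\<in>{(c, d). c = d}. ?g p) = 0"
    by (intro sum.neutral) (auto simp: diag)
  also have "(\<Sum>p\<in>(\<lambda>(c, d). (d, c)) ` Epairs. ?g p) = (\<Sum>p\<in>Epairs. ?g p)"
    by (subst sum.reindex) (auto simp: inj_on_def sym intro!: sum.cong)
  finally show ?thesis by simp
qed

lemma card_Epairs:
  "2 * real (card (Epairs :: ('n::{finite,linorder} \<times> 'n) set)) = real CARD('n) * (real CARD('n) - 1)"
proof -
  let ?f = "\<lambda>c d :: 'n. 1 - (if c = d then 1 else 0) :: real"
  have "2 * (\<Sum>(c, d)\<in>Epairs. ?f c d) = (\<Sum>c\<in>UNIV. \<Sum>d\<in>UNIV. ?f c d)"
    by (rule sum_symmetric_pairs[symmetric]) auto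
  also have "\<dots> = real CARD('n) * (real CARD('n) - 1)"
    by (simp add: sum_subtractf)
  also have "(\<Sum>(c, d)\<in>Epairs. ?f c d) = (\<Sum>p\<in>(Epairs :: ('n \<times> 'n) set). 1)"
    by (intro sum.cong) (auto simp: Epairs_def)
  finally show ?thesis by simp
qed

definition rot_avg :: "'n::finite \<Rightarrow> 'n \<Rightarrow> ('n list \<Rightarrow> real) \<Rightarrow> 'n list \<Rightarrow> real" where
  "rot_avg a b x u = (1 / (2 * pi)) * integral {-pi..pi} (\<lambda>\<theta>. tens_op (rot a b \<theta>) x u)"

lemma deriv_op_integral:
  assumes "\<And>v. (\<lambda>\<theta>. f \<theta> v) integrable_on S"
  shows "deriv_op X (\<lambda>v. integral S (\<lambda>\<theta>. f \<theta> v)) u = integral S (\<lambda>\<theta>. deriv_op X (f \<theta>) u)"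
    and "(\<lambda>\<theta>. deriv_op X (f \<theta>) u) integrable_on S"
  unfolding deriv_op_def site_op_def
  by (simp_all add: integral_sum integrable_sum integrable_on_mult_right assms)

lemma rot_avg_fixed:
  assumes "\<And>\<theta>. tens_op (rot a b \<theta>) x u = x u"
  shows "rot_avg a b x u = x u"
  by (simp add: rot_avg_def assms)

context
  fixes a b :: "'n::finite"
  assumes ab: "a \<noteq> b"
begin

lemma continuous_tens_op_rot: "continuous_on S (\<lambda>\<theta>. tens_op (rot a b \<theta>) x u)"
  by (intro continuous_at_imp_continuous_on ballI DERIV_isCont[OF tens_op_rot_DERIV[OF ab]])

lemma integrable_tens_op_rot: "(\<lambda>\<theta>. tens_op (rot a b \<theta>) x u) integrable_on {l..r}"
  by (intro integrable_continuous_real continuous_tens_op_rot)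

text \<open>The integrand becomes a derivative in the angle, so the integral is a difference of
  endpoint values, and these agree by periodicity.\<close>

lemma rot_gen_rot_avg: "rot_gen a b (rot_avg a b x) u = 0"
proof -
  have "((\<lambda>\<theta>. rot_gen a b (tens_op (rot a b \<theta>) x) u) has_integral
      tens_op (rot a b pi) x u - tens_op (rot a b (-pi)) x u) {-pi..pi}"
    by (intro fundamental_theorem_of_calculus)
      (auto simp: has_real_derivative_iff_has_vector_derivative[symmetric]
        intro: has_field_derivative_at_within tens_op_rot_DERIV[OF ab])
  moreover have "rot a b pi = rot a b (- pi)" by (simp add: rot_def)
  ultimately have "integral {-pi..pi} (\<lambda>\<theta>. rot_gen a b (tens_op (rot a b \<theta>) x) u) = 0"
    by (simp add: integral_unique)
  then show ?thesis
    unfolding rot_avg_def[abs_def] deriv_op_scale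
    by (simp add: deriv_op_integral[OF integrable_tens_op_rot])
qed

text \<open>The rotated vector and the constant \<open>x\<close> solve the same flow equation with
  the same initial value.\<close>

lemma tens_op_rot_of_rot_gen_0:
  assumes "\<And>v. length v = length u \<Longrightarrow> rot_gen a b x v = 0"
  shows "tens_op (rot a b \<theta>) x u = x u"
proof -
  define w where "w = (\<lambda>\<theta> v. tens_op (rot a b \<theta>) x v - x v)"
  have "w \<theta> u = 0"
  proof (rule skew_flow_unique[where w = w and u = u, OF transpose_Emat[of a b]])
    fix s and v :: "'n list" assume "length v = length u"
    then have "deriv_op (Emat a b) (w s) v = deriv_op (Emat a b) (tens_op (rot a b s) x) v"
      unfolding w_def deriv_op_diff using assms by simp
    moreover have "((\<lambda>s. w s v) has_real_derivative deriv_op (Emat a b) (tens_op (rot a b s) x) v - 0) (at s)"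
      unfolding w_def by (intro DERIV_diff tens_op_rot_DERIV[OF ab] DERIV_const)
    ultimately show "((\<lambda>s. w s v) has_real_derivative deriv_op (Emat a b) (w s) v) (at s)" by simp
  qed (simp add: w_def rot_0 tens_op_one)
  then show ?thesis by (simp add: w_def)
qed

lemma rot_avg_idem: "rot_avg a b (rot_avg a b x) u = rot_avg a b x u"
  by (intro rot_avg_fixed tens_op_rot_of_rot_gen_0 rot_gen_rot_avg)

lemma ip_rot_avg_integral:
  "ip (tidx n) (rot_avg a b x) y = (1 / (2 * pi)) * integral {-pi..pi} (\<lambda>\<theta>. ip (tidx n) (tens_op (rot a b \<theta>) x) y)"
proof -
  have "integral {-pi..pi} (\<lambda>\<theta>. ip (tidx n) (tens_op (rot a b \<theta>) x) y)
      = (\<Sum>u\<in>tidx n. integral {-pi..pi} (\<lambda>\<theta>. tens_op (rot a b \<theta>) x u) * y u)"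
    unfolding ip_def
    by (subst integral_sum)
      (auto intro: finite_tidx integrable_on_mult_left integrable_tens_op_rot)
  then show ?thesis by (simp add: ip_def rot_avg_def sum_distrib_left sum_divide_distrib)
qed

text \<open>Transposition reverses the angle, and the interval of integration is symmetric.\<close>

lemma ip_rot_avg: "ip (tidx n) (rot_avg a b x) y = ip (tidx n) x (rot_avg a b y)"
proof -
  have "ip (tidx n) (rot_avg a b x) y
      = (1 / (2 * pi)) * integral {-pi..pi} (\<lambda>\<theta>. ip (tidx n) (tens_op (rot a b (- \<theta>)) y) x)"
    unfolding ip_rot_avg_integral ip_tens_op transpose_rot[OF ab] ip_commute[of _ x] ..
  also have "integral {-pi..pi} (\<lambda>\<theta>. ip (tidx n) (tens_op (rot a b (- \<theta>)) y) x)
      = integral {-pi..pi} (\<lambda>\<theta>. ip (tidx n) (tens_op (rot a b \<theta>) y) x)"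
    using Henstock_Kurzweil_Integration.integral_reflect_real[of pi "-pi" "\<lambda>\<theta>. ip (tidx n) (tens_op (rot a b \<theta>) y) x"]
    by simp
  finally show ?thesis
    by (simp only: ip_rot_avg_integral[symmetric]) (rule ip_commute)
qed

lemma ip_rot_avg_self: "ip (tidx n) (rot_avg a b x) x = ip (tidx n) (rot_avg a b x) (rot_avg a b x)"
  unfolding ip_rot_avg[of n "rot_avg a b x" x, symmetric]
  by (intro ip_cong) (simp_all add: rot_avg_idem)

text \<open>Both sides start at \<open>casimir x\<close> and obey the flow of
  \<open>L\<^sub>a\<^sub>b\<close>, the right one because the Casimir operator commutes with the
  generator.\<close>

lemma casimir_tens_op_rot: "tens_op (rot a b \<theta>) (casimir x) u = casimir (tens_op (rot a b \<theta>) x) u"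
proof -
  define w where "w = (\<lambda>\<theta> v. tens_op (rot a b \<theta>) (casimir x) v - casimir (tens_op (rot a b \<theta>) x) v)"
  have "w \<theta> u = 0"
  proof (rule skew_flow_unique[where w = w and u = u, OF transpose_Emat[of a b]])
    fix s and v :: "'n list"
    have "((\<lambda>s. casimir (tens_op (rot a b s) x) v) has_real_derivative
        casimir (rot_gen a b (tens_op (rot a b s) x)) v) (at s)"
      unfolding casimir_def
      by (intro DERIV_minus DERIV_sum deriv_op_DERIV tens_op_rot_DERIV[OF ab])
    then have "((\<lambda>s. w s v) has_real_derivative
        rot_gen a b (tens_op (rot a b s) (casimir x)) v - casimir (rot_gen a b (tens_op (rot a b s) x)) v) (at s)"
      unfolding w_def by (intro DERIV_diff tens_op_rot_DERIV[OF ab])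
    then show "((\<lambda>s. w s v) has_real_derivative rot_gen a b (w s) v) (at s)"
      unfolding w_def deriv_op_diff casimir_commute .
  qed (simp add: w_def rot_0 tens_op_one[abs_def])
  then show ?thesis by (simp add: w_def)
qed

lemma rot_avg_casimir: "rot_avg a b (casimir x) u = casimir (rot_avg a b x) u"
proof -
  let ?T = "\<lambda>\<theta>. tens_op (rot a b \<theta>) x"
  note int = deriv_op_integral[OF deriv_op_integral(2)[OF integrable_tens_op_rot]]
  have int1: "rot_gen c d (\<lambda>v. integral {-pi..pi} (\<lambda>\<theta>. ?T \<theta> v))
      = (\<lambda>v. integral {-pi..pi} (\<lambda>\<theta>. rot_gen c d (?T \<theta>) v))" for c d
    by (rule ext) (rule deriv_op_integral(1)[OF integrable_tens_op_rot])
  have "casimir (rot_avg a b x) u = (1 / (2 * pi)) *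
      (- (\<Sum>c\<in>UNIV. \<Sum>d\<in>UNIV. integral {-pi..pi} (\<lambda>\<theta>. rot_gen c d (rot_gen c d (?T \<theta>)) u)))"
    unfolding casimir_def rot_avg_def[abs_def] deriv_op_scale int1
    by (simp add: int(1) sum_distrib_left sum_divide_distrib)
  also have "- (\<Sum>c\<in>UNIV. \<Sum>d\<in>UNIV. integral {-pi..pi} (\<lambda>\<theta>. rot_gen c d (rot_gen c d (?T \<theta>)) u))
      = integral {-pi..pi} (\<lambda>\<theta>. casimir (?T \<theta>) u)"
    unfolding casimir_def by (simp add: integral_sum integrable_sum int(2))
  finally show ?thesis
    by (simp only: rot_avg_def[of _ _ "casimir x"] casimir_tens_op_rot)
qed

text \<open>The lower bound is applied to the component \<open>x\<close> of \<open>v\<close> in the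
  kernel of the average. The generator does not distinguish \<open>x\<close> from \<open>v\<close>,
  and since the Casimir operator commutes with the average, one \<open>x\<close> in the quadratic
  form may be replaced by \<open>v\<close>.\<close>

lemma casimir_rot_avg_bound:
  fixes v :: "'n list \<Rightarrow> real"
  assumes "0 < n"
  shows "2 * (1 + (real CARD('n) - 2) / real n) * ip (tidx n) (rot_gen a b v) (rot_gen a b v)
     \<le> ip (tidx n) (casimir v) (\<lambda>u. v u - rot_avg a b v u)"
proof -
  define x where "x = (\<lambda>u. v u - rot_avg a b v u)"
  have Lx: "rot_gen a b x = rot_gen a b v"
    unfolding x_def deriv_op_diff rot_gen_rot_avg by simp
  have Cx: "casimir x = (\<lambda>u. casimir v u - casimir (rot_avg a b v) u)"
    unfolding x_def casimir_def[abs_def] deriv_op_diff by (simp add: sum_subtractf)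
  have "ip (tidx n) (casimir (rot_avg a b v)) x = ip (tidx n) (casimir v) (rot_avg a b x)"
    unfolding rot_avg_casimir[symmetric] by (rule ip_rot_avg)
  also have "rot_avg a b x = (\<lambda>u. 0)"
  proof
    fix u
    have "rot_avg a b x u = rot_avg a b v u - rot_avg a b (rot_avg a b v) u"
      unfolding x_def rot_avg_def[of a b "\<lambda>u. _ u - _ u"] tens_op_diff
      by (simp add: integral_diff integrable_tens_op_rot rot_avg_def diff_divide_distrib)
    then show "rot_avg a b x u = 0" by (simp add: rot_avg_idem)
  qed
  finally have "ip (tidx n) (casimir x) x = ip (tidx n) (casimir v) x"
    unfolding Cx ip_linear by (simp add: ip_def)
  then show ?thesis
    using casimir_lower_bound[OF ab assms, of x] unfolding Lx by (simp add: x_def)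
qed

end

text \<open>Summing the bounds over all planes gives \<open>g * ?C\<close> on the left; on the right
  the eigenvalue equation turns the sum into \<open>D * (1 - l) * ?C\<close>. Positivity of
  \<open>?C\<close> allows division.\<close>

lemma rot_avg_mean_eigenvalue_le:
  fixes v :: "'n::{finite,linorder} list \<Rightarrow> real"
  defines "D \<equiv> real (card (Epairs :: ('n \<times> 'n) set))"
  assumes n: "0 < n" and D: "0 < D"
    and eig: "\<And>u. u \<in> tidx n \<Longrightarrow> (1 / D) * (\<Sum>(a, b)\<in>Epairs. rot_avg a b v u) = l * v u"
    and pos: "0 < ip (tidx n) (casimir v) v"
  shows "l \<le> 1 - (1 + (real CARD('n) - 2) / real n) / D"
proof -
  let ?I = "tidx n" and ?C = "ip (tidx n) (casimir v) v"
  define g where "g = 1 + (real CARD('n) - 2) / real n"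
  define q where "q c d = ip ?I (rot_gen c d v) (rot_gen c d v)" for c d
  have "?C = 2 * (\<Sum>(c, d)\<in>Epairs. q c d)"
    unfolding ip_casimir q_def
  proof (rule sum_symmetric_pairs)
    fix c d
    show "ip ?I (rot_gen c d v) (rot_gen c d v) = ip ?I (rot_gen d c v) (rot_gen d c v)"
      unfolding rot_gen_swap[of d c] ip_linear by simp
    show "ip ?I (rot_gen c c v) (rot_gen c c v) = 0"
      unfolding rot_gen_self by (simp add: ip_def)
  qed
  then have "g * ?C = (\<Sum>(a, b)\<in>Epairs. 2 * g * q a b)"
    by (simp add: sum_distrib_left case_prod_unfold mult_ac)
  also have "\<dots> \<le> (\<Sum>(a, b)\<in>Epairs. ip ?I (casimir v) (\<lambda>u. v u - rot_avg a b v u))"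
  proof (rule sum_mono)
    fix p :: "'n \<times> 'n" assume "p \<in> Epairs"
    then obtain a b where p: "p = (a, b)" "a \<noteq> b" by (auto simp: Epairs_def)
    show "(case p of (a, b) \<Rightarrow> 2 * g * q a b) \<le> (case p of (a, b) \<Rightarrow> ip ?I (casimir v) (\<lambda>u. v u - rot_avg a b v u))"
      unfolding p g_def q_def prod.case by (rule casimir_rot_avg_bound[OF p(2) n])
  qed
  also have "\<dots> = D * ?C - ip ?I (casimir v) (\<lambda>u. \<Sum>(a, b)\<in>Epairs. rot_avg a b v u)"
    unfolding ip_diff_right case_prod_unfold ip_sum_right sum_subtractf by (simp add: D_def)
  also have "ip ?I (casimir v) (\<lambda>u. \<Sum>(a, b)\<in>Epairs. rot_avg a b v u) = ip ?I (casimir v) (\<lambda>u. (D * l) * v u)"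
  proof (rule ip_cong)
    show "(\<Sum>(a, b)\<in>Epairs. rot_avg a b v u) = D * l * v u" if "u \<in> ?I" for u
      using eig[OF that] D by (simp add: field_simps)
  qed simp
  also have "\<dots> = D * l * ?C" by (simp only: ip_linear)
  finally have "g * ?C \<le> (D - D * l) * ?C" by (simp add: algebra_simps)
  then have "g \<le> D - D * l" using pos by simp
  then show ?thesis using D unfolding g_def[symmetric] by (simp add: field_simps)
qed

section \<open>The Haar average\<close>

text \<open>Induction over a word in plane rotations representing \<open>Q\<close>, for all lists of
  the given length at once, since tensor operators mix them.\<close>

lemma tens_op_SO_fixed:
  fixes x :: "'n::finite list \<Rightarrow> real"
  assumes fixed: "\<And>a b \<theta> v. a \<noteq> b \<Longrightarrow> length v = length u \<Longrightarrow> tens_op (rot a b \<theta>) x v = x v"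
    and "Q \<in> SO"
  shows "tens_op Q x u = x u"
proof -
  have "\<forall>v :: 'n list. length v = length u \<longrightarrow> tens_op Q x v = x v"
    using SO_subset_rots[OF \<open>Q \<in> SO\<close>]
  proof (induction rule: rots.induct)
    case one
    show ?case by (simp add: tens_op_one)
  next
    case (mult a b A \<theta>)
    show ?case
    proof (intro allI impI)
      fix v :: "'n list" assume v: "length v = length u"
      have "tens_op (rot a b \<theta> ** A) x v = tens_op (rot a b \<theta>) (tens_op A x) v"
        by (rule tens_op_mult[symmetric])
      also have "\<dots> = tens_op (rot a b \<theta>) x v"
        by (rule tens_op_cong) (simp add: mult.IH v)
      also have "\<dots> = x v" by (rule fixed[OF mult.hyps(1) v])
      finally show "tens_op (rot a b \<theta> ** A) x v = x v" .
    qed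
  qed
  then show ?thesis by simp
qed

lemma abs_tens_pow_SO_le_1:
  assumes "Q \<in> SO"
  shows "\<bar>tens_pow Q n u v\<bar> \<le> 1"
proof -
  have "\<bar>Q $ i $ j\<bar> \<le> 1" for i j
  proof -
    have "Q $ i $ j * Q $ i $ j \<le> (\<Sum>k\<in>UNIV. Q $ k $ j * Q $ k $ j)"
      by (rule member_le_sum) auto
    then have "(Q $ i $ j)\<^sup>2 \<le> 1" using SO_column_inner[OF assms, of j j] by (simp add: power2_eq_square)
    then show ?thesis by (simp add: abs_square_le_1)
  qed
  then show ?thesis by (auto simp: tens_pow_def abs_prod intro!: prod_le_1)
qed

definition haar_avg :: "(real^'n^'n) measure \<Rightarrow> ('n::finite list \<Rightarrow> real) \<Rightarrow> 'n list \<Rightarrow> real" where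
  "haar_avg \<mu> x u = (\<integral>Q. tens_op Q x u \<partial>\<mu>)"

lemma measurable_tens_pow: "(\<lambda>Q. tens_pow Q n u v) \<in> borel_measurable borel"
  unfolding tens_pow_def by (intro borel_measurable_continuous_onI continuous_intros)

lemma measurable_tens_op: "(\<lambda>Q. tens_op Q x u) \<in> borel_measurable borel"
  unfolding tens_op_def by (intro borel_measurable_sum borel_measurable_times measurable_tens_pow) simp

context
  fixes \<mu> :: "(real^'n^'n) measure"
  assumes haar: "haar_SO \<mu>"
begin

interpretation prob_space \<mu>
  using haar by (simp add: haar_SO_def)

lemma sets_haar: "sets \<mu> = sets borel"
  using haar by (simp add: haar_SO_def)

lemma AE_haar_SO: "AE Q in \<mu>. Q \<in> SO"
proof -
  have e: "emeasure \<mu> SO = 1" using haar by (simp add: haar_SO_def)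
  \<comment> \<open>A set outside the sigma-algebra has \<open>emeasure\<close> 0 by convention, so
    the value 1 already shows measurability.\<close>
  then have "SO \<in> events" using emeasure_notin_sets by fastforce
  moreover have "prob SO = 1" using e by (simp add: measure_def)
  ultimately show ?thesis using prob_eq_1 by simp
qed

lemma borel_measurable_haar: "f \<in> borel_measurable borel \<Longrightarrow> f \<in> borel_measurable \<mu>"
  by (simp cong: measurable_cong_sets add: sets_haar)

lemma integrable_tens_pow: "integrable \<mu> (\<lambda>Q. tens_pow Q n u v)"
proof (rule integrable_const_bound)
  show "AE Q in \<mu>. norm (tens_pow Q n u v) \<le> 1"
    using AE_haar_SO by eventually_elim (simp add: abs_tens_pow_SO_le_1)
qed (intro borel_measurable_haar measurable_tens_pow)

lemma integrable_tens_op: "integrable \<mu> (\<lambda>Q. tens_op Q x u)"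
  unfolding tens_op_def by (intro Bochner_Integration.integrable_sum integrable_mult_left integrable_tens_pow)

lemma haar_avg_entries: "haar_avg \<mu> x u = (\<Sum>v\<in>tidx (length u). (\<integral>Q. tens_pow Q (length u) u v \<partial>\<mu>) * x v)"
  unfolding haar_avg_def tens_op_def by (simp add: integrable_tens_pow)

lemma haar_avg_invariant:
  assumes g: "g \<in> SO"
  shows "tens_op g (haar_avg \<mu> x) u = haar_avg \<mu> x u"
proof -
  have "continuous_on UNIV (\<lambda>Q. g ** Q)"
    by (intro linear_continuous_on linear_conv_bounded_linear[THEN iffD1] linearI)
      (simp_all add: matrix_mult_add_right matrix_mult_scaleR)
  then have meas: "(\<lambda>Q. g ** Q) \<in> measurable \<mu> borel"
    by (intro borel_measurable_haar borel_measurable_continuous_onI)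
  have "tens_op g (haar_avg \<mu> x) u = (\<integral>Q. tens_op g (tens_op Q x) u \<partial>\<mu>)"
    unfolding tens_op_def[of g] haar_avg_def by (simp add: integrable_tens_op)
  also have "\<dots> = (\<integral>Q. tens_op (g ** Q) x u \<partial>\<mu>)"
    by (simp only: tens_op_mult)
  also have "\<dots> = (\<integral>Q. tens_op Q x u \<partial>distr \<mu> borel (\<lambda>Q. g ** Q))"
    by (rule integral_distr[symmetric, OF meas measurable_tens_op])
  also have "distr \<mu> borel (\<lambda>Q. g ** Q) = \<mu>"
    using haar g by (simp add: haar_SO_def)
  finally show ?thesis by (simp add: haar_avg_def[abs_def])
qed

lemma haar_avg_fixed:
  assumes "\<And>Q. Q \<in> SO \<Longrightarrow> tens_op Q x u = x u"
  shows "haar_avg \<mu> x u = x u"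
proof -
  have "haar_avg \<mu> x u = (\<integral>Q. x u \<partial>\<mu>)"
    unfolding haar_avg_def
  proof (rule integral_cong_AE)
    show "AE Q in \<mu>. tens_op Q x u = x u"
      using AE_haar_SO by eventually_elim (rule assms)
  qed (auto intro: borel_measurable_haar measurable_tens_op)
  then show ?thesis by (simp add: prob_space)
qed

text \<open>Under the integral \<open>Q\<close> moves to the other argument as its transpose, which
  is again in \<open>SO\<close> and fixes \<open>w\<close>.\<close>

lemma ip_haar_avg_fixed:
  assumes "\<And>Q u. Q \<in> SO \<Longrightarrow> length u = n \<Longrightarrow> tens_op Q w u = w u"
  shows "ip (tidx n) (haar_avg \<mu> x) w = ip (tidx n) x w"
proof -
  have "ip (tidx n) (haar_avg \<mu> x) w = (\<integral>Q. ip (tidx n) (tens_op Q x) w \<partial>\<mu>)"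
    unfolding ip_def haar_avg_def by (simp add: integrable_tens_op)
  also have "\<dots> = (\<integral>Q. ip (tidx n) x w \<partial>\<mu>)"
  proof (rule integral_cong_AE)
    show "AE Q in \<mu>. ip (tidx n) (tens_op Q x) w = ip (tidx n) x w"
      using AE_haar_SO
    proof eventually_elim
      case (elim Q)
      then show ?case
        unfolding ip_tens_op by (intro ip_cong) (auto simp: assms SO_transpose length_tidx)
    qed
    show "(\<lambda>Q. ip (tidx n) (tens_op Q x) w) \<in> borel_measurable \<mu>"
      unfolding ip_def
      by (intro borel_measurable_haar borel_measurable_sum borel_measurable_times measurable_tens_op) simp
  qed simp
  finally show ?thesis by (simp add: prob_space)
qed

text \<open>Symmetry and idempotence of the projection in one identity: left invariance makes
  \<open>haar_avg \<mu> x\<close> a fixed vector, and pairing with a fixed vector does not see the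
  averaging of \<open>y\<close>.\<close>

lemma ip_haar_avg: "ip (tidx n) (haar_avg \<mu> x) y = ip (tidx n) (haar_avg \<mu> x) (haar_avg \<mu> y)"
  using ip_haar_avg_fixed[of n "haar_avg \<mu> x" y] by (simp add: haar_avg_invariant ip_commute[of _ "haar_avg \<mu> x"])

end

section \<open>The mean over all coordinate planes and the final estimate\<close>

definition mean_rot_avg :: "('n::{finite,linorder} list \<Rightarrow> real) \<Rightarrow> 'n list \<Rightarrow> real" where
  "mean_rot_avg x u = (1 / real (card (Epairs :: ('n \<times> 'n) set))) * (\<Sum>(a, b)\<in>Epairs. rot_avg a b x u)"

lemma ip_mean_rot_avg:
  "ip (tidx n) (mean_rot_avg x) y = ip (tidx n) x (mean_rot_avg y)"
proof -
  have "ip (tidx n) (\<lambda>u. \<Sum>(a, b)\<in>Epairs. rot_avg a b x u) y = (\<Sum>(a, b)\<in>Epairs. ip (tidx n) (rot_avg a b x) y)"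
    by (simp add: ip_sum_left case_prod_unfold)
  also have "\<dots> = (\<Sum>(a, b)\<in>Epairs. ip (tidx n) x (rot_avg a b y))"
    by (intro sum.cong) (auto simp: Epairs_def ip_rot_avg)
  also have "\<dots> = ip (tidx n) x (\<lambda>u. \<Sum>(a, b)\<in>Epairs. rot_avg a b y u)"
    by (simp add: ip_sum_right case_prod_unfold)
  finally show ?thesis unfolding mean_rot_avg_def[abs_def] ip_linear by simp
qed

lemma mean_rot_avg_fixed:
  fixes x :: "'n::{finite,linorder} list \<Rightarrow> real"
  assumes "0 < card (Epairs :: ('n \<times> 'n) set)"
    and "\<And>Q. Q \<in> SO \<Longrightarrow> tens_op Q x u = x u"
  shows "mean_rot_avg x u = x u"
proof -
  have "(\<Sum>(a, b)\<in>Epairs. rot_avg a b x u) = (\<Sum>p\<in>(Epairs :: ('n \<times> 'n) set). x u)"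
    by (intro sum.cong) (auto simp: Epairs_def intro!: rot_avg_fixed assms(2) rot_in_SO)
  then show ?thesis using assms(1) by (simp add: mean_rot_avg_def card_gt_0_iff)
qed

lemma rot_avg_entries:
  assumes ab: "a \<noteq> b"
  shows "rot_avg a b x u = (\<Sum>v\<in>tidx (length u). ((1 / (2 * pi)) *
    integral {-pi..pi} (\<lambda>\<theta>. tens_pow (mat_exp (\<theta> *\<^sub>R Emat a b)) (length u) u v)) * x v)"
proof -
  have c: "(\<lambda>\<theta>. tens_pow (rot a b \<theta>) (length u) u v) integrable_on {-pi..pi}" for v
    unfolding tens_pow_def
    by (intro integrable_continuous_real continuous_intros continuous_at_imp_continuous_on ballI
        DERIV_isCont[OF rot_DERIV[OF ab]])
  show ?thesis
    unfolding rot_avg_def tens_op_def mat_exp_Emat[OF ab]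
    by (simp add: integral_sum integrable_on_mult_left c finite_tidx sum_distrib_left sum_divide_distrib)
qed

theorem theorem6p2:
  fixes t :: nat and \<mu> :: "((real, 'n::{finite,linorder}) vec, 'n) vec measure"
  assumes "CARD('n) \<ge> 3" and "t \<ge> 1" and "haar_SO \<mu>"
  shows "op_norm (tidx t :: 'n list set)
           (\<lambda>is js. (1 / real (card (Epairs :: ('n \<times> 'n) set))) *
                      (\<Sum>(a, b)\<in>Epairs. (1 / (2 * pi)) *
                         integral {-pi..pi} (\<lambda>\<theta>. tens_pow (mat_exp (\<theta> *\<^sub>R Emat a b)) t is js))
                    - (\<integral>Q. tens_pow Q t is js \<partial>\<mu>))
         \<le> 1 - (1 / real t) * (2 * (real CARD('n) - 2) / (real CARD('n) * (real CARD('n) - 1)))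
             - 2 / (real CARD('n) * (real CARD('n) - 1))"
    (is "op_norm ?I ?M \<le> ?q")
proof (rule op_norm_le_eigenvalue_bound)
  define N where "N = real CARD('n)"
  define D where "D = real (card (Epairs :: ('n \<times> 'n) set))"
  have N: "3 \<le> N" using assms(1) by (simp add: N_def)
  have t: "1 \<le> real t" using assms(2) by simp
  have D_eq: "D = N * (N - 1) / 2" using card_Epairs[where 'n = 'n] by (simp add: D_def N_def)
  have Dpos: "0 < D" unfolding D_eq using N by simp
  then have card_pos: "0 < card (Epairs :: ('n \<times> 'n) set)" by (simp add: D_def)
  have q_eq: "?q = 1 - (1 + (N - 2) / real t) / D"
    unfolding D_eq N_def[symmetric] by (simp add: distrib_right add_divide_distrib mult.commute)
  let ?h = "haar_avg \<mu>"
  have M: "(\<Sum>v\<in>?I. ?M u v * x v) = mean_rot_avg x u - ?h x u" if "u \<in> ?I" for x u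
  proof -
    have len: "length u = t" using that by (rule length_tidx)
    let ?m = "\<lambda>(a, b) v. (1 / (2 * pi)) * integral {-pi..pi} (\<lambda>\<theta>. tens_pow (mat_exp (\<theta> *\<^sub>R Emat a b)) t u v)"
    have "mean_rot_avg x u = (1 / D) * (\<Sum>p\<in>Epairs. \<Sum>v\<in>?I. ?m p v * x v)"
      unfolding mean_rot_avg_def D_def
      by (intro arg_cong2[of _ _ _ _ "(*)"] sum.cong refl) (auto simp: Epairs_def rot_avg_entries len)
    also have "\<dots> = (\<Sum>v\<in>?I. (1 / D) * (\<Sum>p\<in>Epairs. ?m p v) * x v)"
      unfolding sum.swap[of _ ?I] by (simp only: sum_distrib_left sum_distrib_right mult.assoc)
    finally show ?thesis
      unfolding haar_avg_entries[OF assms(3)] len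
      by (simp add: left_diff_distrib sum_subtractf D_def case_prod_unfold)
  qed
  have inv: "tens_op Q (?h x) u = ?h x u" if "Q \<in> SO" for Q x u
    by (rule haar_avg_invariant[OF assms(3) that])
  have ip_h: "ip ?I (?h x) y = ip ?I (?h x) (?h y)" for x y
    by (rule ip_haar_avg[OF assms(3)])
  have mean_h: "mean_rot_avg (?h x) = ?h x" for x
    by (rule ext) (rule mean_rot_avg_fixed[OF card_pos inv])
  have ipM: "ip ?I (\<lambda>u. \<Sum>v\<in>?I. ?M u v * x v) y = ip ?I (mean_rot_avg x) y - ip ?I (?h x) (?h y)" for x y
  proof -
    have "ip ?I (\<lambda>u. \<Sum>v\<in>?I. ?M u v * x v) y = ip ?I (\<lambda>u. mean_rot_avg x u - ?h x u) y"
      by (intro ip_cong M refl)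
    then show ?thesis by (simp only: ip_diff_left ip_h[of x y])
  qed
  show "finite ?I" by (rule finite_tidx)
  show "?I \<noteq> {}" by (rule tidx_nonempty)
  show "0 \<le> ?q"
  proof -
    \<comment> \<open>The numerator \<open>1 + (N - 2) / t\<close> is at most N - 1, which is at
      most the number \<open>D = N * (N - 1) / 2\<close> of planes.\<close>
    have "(N - 2) / real t \<le> N - 2" using divide_left_mono[OF t, of "N - 2"] N t by simp
    then have "1 + (N - 2) / real t \<le> N - 1" by simp
    also have "\<dots> \<le> D" unfolding D_eq using mult_right_mono[of 2 N "N - 1"] N by simp
    finally show ?thesis unfolding q_eq using Dpos by (simp add: field_simps)
  qed
  show "ip ?I (\<lambda>u. \<Sum>v\<in>?I. ?M u v * x v) y = ip ?I x (\<lambda>u. \<Sum>v\<in>?I. ?M u v * y v)" for x y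
    unfolding ipM ip_commute[of ?I x] 
    by (simp add: ip_mean_rot_avg[of t x y] ip_commute[of ?I x] ip_commute[of ?I "?h x" "?h y"])
  show "0 \<le> ip ?I (\<lambda>u. \<Sum>v\<in>?I. ?M u v * x v) x" for x
  proof -
    \<comment> \<open>The range of the Haar projection lies in that of every plane projection, so
      each plane projection dominates it as a quadratic form, and so does their mean.\<close>
    have "ip ?I (?h x) (?h x) \<le> ip ?I (rot_avg a b x) x" if ab: "a \<noteq> b" for a b
    proof -
      have "rot_avg a b (?h x) = ?h x"
        by (rule ext) (intro rot_avg_fixed inv rot_in_SO ab)
      then have "ip ?I (rot_avg a b x) (?h x) = ip ?I (?h x) (?h x)"
        unfolding ip_rot_avg[OF ab] by (simp add: ip_commute[of _ x] ip_h[of x x])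
      moreover have "0 \<le> ip ?I (\<lambda>u. rot_avg a b x u - ?h x u) (\<lambda>u. rot_avg a b x u - ?h x u)"
        by (rule ip_nonneg)
      ultimately show ?thesis
        unfolding ip_linear ip_rot_avg_self[OF ab] by (simp add: ip_commute)
    qed
    then have "(\<Sum>p\<in>(Epairs :: ('n \<times> 'n) set). ip ?I (?h x) (?h x)) \<le> (\<Sum>(a, b)\<in>Epairs. ip ?I (rot_avg a b x) x)"
      by (intro sum_mono) (auto simp: Epairs_def)
    also have "\<dots> = D * ip ?I (mean_rot_avg x) x"
      unfolding mean_rot_avg_def[abs_def] ip_linear case_prod_unfold ip_sum_left using Dpos by (simp add: D_def)
    finally show ?thesis unfolding ipM using Dpos by (simp add: D_def)
  qed
  show "l \<le> ?q" if l: "0 < l" and nz: "\<exists>u\<in>?I. v u \<noteq> 0"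
    and eig: "\<forall>u\<in>?I. (\<Sum>w\<in>?I. ?M u w * v w) = l * v u" for l v
  proof -
    \<comment> \<open>The difference of averages annihilates the range of the Haar projection, so by
      symmetry an eigenvector for \<open>l > 0\<close> is orthogonal to it, and its Haar average is
      zero.\<close>
    have "l * ip ?I v (?h v) = ip ?I (\<lambda>u. l * v u) (?h v)" by (simp only: ip_scale_left)
    also have "\<dots> = ip ?I (\<lambda>u. \<Sum>w\<in>?I. ?M u w * v w) (?h v)"
      using eig by (intro ip_cong) auto
    also have "\<dots> = 0"
      unfolding ipM ip_mean_rot_avg mean_h
      by (simp add: ip_commute[of _ v] ip_h[of v v] ip_h[of v "?h v", symmetric])
    finally have "ip ?I v (?h v) = 0" using l by simp
    then have "ip ?I (?h v) (?h v) = 0"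
      by (simp add: ip_commute[of _ v] ip_h[of v v])
    then have h0: "?h v u = 0" if "u \<in> ?I" for u
      using that by (simp add: ip_eq_0_iff finite_tidx)
    have "0 < ip ?I (casimir v) v"
    \<comment> \<open>If the Casimir form vanished at \<open>v\<close>, every generator would kill
      \<open>v\<close>; then \<open>v\<close> would be fixed by \<open>SO\<close> and equal its own
      Haar average, which is zero.\<close>
    proof (rule ccontr)
      assume "\<not> ?thesis"
      then have "(\<Sum>c\<in>UNIV. \<Sum>d\<in>UNIV. ip ?I (rot_gen c d v) (rot_gen c d v)) \<le> 0"
        by (simp add: ip_casimir)
      then have "(\<Sum>c\<in>UNIV. \<Sum>d\<in>UNIV. ip ?I (rot_gen c d v) (rot_gen c d v)) = 0"
        by (intro antisym sum_nonneg ip_nonneg)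
      then have "ip ?I (rot_gen c d v) (rot_gen c d v) = 0" for c d
        by (simp add: sum_nonneg_eq_0_iff sum_nonneg ip_nonneg)
      then have L0: "rot_gen c d v u = 0" if "length u = t" for c d u
        using that by (simp add: ip_eq_0_iff finite_tidx) (simp add: tidx_def)
      have "tens_op (rot a b \<theta>) v u = v u" if "a \<noteq> b" "length u = t" for a b \<theta> u
        using that by (intro tens_op_rot_of_rot_gen_0 L0) auto
      then have "tens_op Q v u = v u" if "Q \<in> SO" "length u = t" for Q u
        by (rule tens_op_SO_fixed) (use that in auto)
      then have "?h v u = v u" if "u \<in> ?I" for u
        using length_tidx[OF that] by (intro haar_avg_fixed[OF assms(3)])
      then show False using h0 nz by auto
    qed
    moreover have "(1 / D) * (\<Sum>(a, b)\<in>Epairs. rot_avg a b v u) = l * v u" if "u \<in> ?I" for u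
      using eig M[OF that, of v] h0[OF that] that by (simp add: mean_rot_avg_def D_def)
    ultimately have "l \<le> 1 - (1 + (real CARD('n) - 2) / real t) / D"
      unfolding D_def using assms(2) Dpos by (intro rot_avg_mean_eigenvalue_le) (auto simp: D_def)
    then show ?thesis unfolding q_eq N_def .
  qed
qed

end
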